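(* Let $(M_1,g_1)$ and $(M_2,g_2)$ be pseudo-Riemannian manifolds with $n_2=\dim M_2$, let $f:M_1\to(0,\infty)$ be smooth, and let $(M,g)=(M_1\times_f M_2,\ g_1\oplus f^2g_2)$ be the warped product. Let $\zeta=\zeta_1+\zeta_2$ with $\zeta_i\in\mathfrak{X}(M_i)$ (lifted to $M$), let $\lambda\in\mathbb{R}$, and suppose that $(M,g,\zeta,\lambda)$ is a Ricci soliton. Then: (1) If $\eta_1\in\mathfrak{X}(M_1)$ is a vector field such that $\frac{n_2}{f}D^1_{X_1}\nabla^1 f=D^1_{X_1}\eta_1$ for every $X_1\in\mathfrak{X}(M_1)$, then $(M_1,g_1,\zeta_1-\eta_1,\lambda)$ is a Ricci soliton. (2) If the function $\lambda f^2+f^{\sharp}-f\zeta_1(f)$ on $M_1$ is constant, then $(M_2,g_2,f^2\zeta_2,\ \lambda f^2+f^{\sharp}-f\zeta_1(f))$ is a Ricci soliton, where $f^2\zeta_2$ is regarded as a vector field on $M_2$ by evaluating $f$ at an arbitrary fixed point of $M_1$.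
   Context: A Ricci soliton $(N,h,\xi,\lambda)$ is a pseudo-Riemannian manifold $(N,h)$ with a vector field $\xi$ and a real constant $\lambda$ such that $\frac12\mathcal{L}_\xi h+\mathrm{Ric}=\lambda h$, where $\mathrm{Ric}$ is the Ricci tensor of $h$ and $\mathcal{L}$ is the Lie derivative. The warped product $M_1\times_f M_2$ is $M_1\times M_2$ with metric $\pi_1^*g_1+(f\circ\pi_1)^2\pi_2^*g_2$, where $\pi_i$ are the projections. Tensor fields on the factors and their lifts to the product are denoted by the same symbol. $D^1$ and $\nabla^1$ are the Levi-Civita connection and gradient of $(M_1,g_1)$. $f^{\sharp}=f\Delta f+(n_2-1)\|\nabla f\|_1^2$, where $\Delta f$ is the trace of the Hessian of $f$ on $(M_1,g_1)$ and $\|\nabla f\|_1^2=g_1(\nabla^1 f,\nabla^1 f)$. *)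

theory Defs
  imports "HOL-Analysis.Analysis"
begin

section \<open>Smooth maps between Euclidean spaces\<close>

(* Meant for open S only: the derivatives are taken at x, not at x within S. *)
primrec Ck_on :: "nat \<Rightarrow> 'e::euclidean_space set \<Rightarrow> ('e \<Rightarrow> 'f::real_normed_vector) \<Rightarrow> bool" where
  "Ck_on 0 S f \<longleftrightarrow> continuous_on S f"
| "Ck_on (Suc k) S f \<longleftrightarrow>
     (\<forall>x\<in>S. f differentiable (at x)) \<and> (\<forall>v. Ck_on k S (\<lambda>x. frechet_derivative f (at x) v))"

definition smooth_on :: "'e::euclidean_space set \<Rightarrow> ('e \<Rightarrow> 'f::real_normed_vector) \<Rightarrow> bool" where
  "smooth_on S f \<longleftrightarrow> (\<forall>k. Ck_on k S f)"


section \<open>Smooth manifolds\<close>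

datatype ('a, 'e) chart = Chart (chart_dom: "'a set") (chart_map: "'a \<Rightarrow> 'e")

record ('a, 'e) manifold =
  topo :: "'a topology"
  atlas :: "('a, 'e) chart set"

abbreviation points :: "('a, 'e) manifold \<Rightarrow> 'a set" where
  "points M \<equiv> topspace (topo M)"

definition chart_inv :: "('a, 'e) chart \<Rightarrow> 'e \<Rightarrow> 'a" where
  "chart_inv c = inv_into (chart_dom c) (chart_map c)"

definition chart_range :: "('a, 'e) chart \<Rightarrow> 'e set" where
  "chart_range c = chart_map c ` chart_dom c"

definition charts_at :: "('a, 'e) manifold \<Rightarrow> 'a \<Rightarrow> ('a, 'e) chart set" where
  "charts_at M p = {c \<in> atlas M. p \<in> chart_dom c}"

definition some_chart :: "('a, 'e) manifold \<Rightarrow> 'a \<Rightarrow> ('a, 'e) chart" where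
  "some_chart M p = (SOME c. c \<in> charts_at M p)"

(* The atlas need not be maximal; it represents the smooth structure it generates. *)
definition smooth_manifold :: "('a, 'e::euclidean_space) manifold \<Rightarrow> bool" where
  "smooth_manifold M \<longleftrightarrow>
     points M \<noteq> {} \<and> Hausdorff_space (topo M) \<and> second_countable (topo M) \<and>
     (\<Union>c\<in>atlas M. chart_dom c) = points M \<and>
     (\<forall>c\<in>atlas M. openin (topo M) (chart_dom c) \<and> open (chart_range c) \<and>
        homeomorphic_map (subtopology (topo M) (chart_dom c)) (top_of_set (chart_range c))
          (chart_map c)) \<and>
     (\<forall>c\<in>atlas M. \<forall>d\<in>atlas M.
        smooth_on (chart_map c ` (chart_dom c \<inter> chart_dom d)) (chart_map d \<circ> chart_inv c))"

definition fun_in :: "('a, 'e) chart \<Rightarrow> ('a \<Rightarrow> 'b) \<Rightarrow> 'e \<Rightarrow> 'b" where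
  "fun_in c f = f \<circ> chart_inv c"

definition smooth_fun :: "('a, 'e::euclidean_space) manifold \<Rightarrow> ('a \<Rightarrow> real) \<Rightarrow> bool" where
  "smooth_fun M f \<longleftrightarrow> (\<forall>c\<in>atlas M. smooth_on (chart_range c) (fun_in c f))"


section \<open>Tangent vectors, vector fields and metrics\<close>

(* A tangent vector at p is the family of its components in the charts around p, related by the
   derivatives of the chart transitions. The components for all other charts are 0, so that
   equality of tangent vectors is equality of functions. *)
type_synonym ('a, 'e) tvec = "('a, 'e) chart \<Rightarrow> 'e"

definition tangent_space :: "('a, 'e::euclidean_space) manifold \<Rightarrow> 'a \<Rightarrow> ('a, 'e) tvec set" where
  "tangent_space M p =
     {v. (\<forall>c\<in>charts_at M p. \<forall>d\<in>charts_at M p.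
            v d = frechet_derivative (chart_map d \<circ> chart_inv c) (at (chart_map c p)) (v c)) \<and>
         (\<forall>c. c \<notin> charts_at M p \<longrightarrow> v c = 0)}"

(* The tangent vector at p whose component in the chart c is x. *)
definition coord_vec ::
  "('a, 'e::euclidean_space) manifold \<Rightarrow> ('a, 'e) chart \<Rightarrow> 'a \<Rightarrow> 'e \<Rightarrow> ('a, 'e) tvec" where
  "coord_vec M c p x =
     (\<lambda>d. if d \<in> charts_at M p
          then frechet_derivative (chart_map d \<circ> chart_inv c) (at (chart_map c p)) x else 0)"

definition tangent_map :: "('a, 'e::euclidean_space) manifold \<Rightarrow> ('b, 'f::euclidean_space) manifold \<Rightarrow>
    ('a \<Rightarrow> 'b) \<Rightarrow> 'a \<Rightarrow> ('a, 'e) tvec \<Rightarrow> ('b, 'f) tvec" where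
  "tangent_map M N F p v =
     (let c = some_chart M p in
      (\<lambda>d. if d \<in> charts_at N (F p)
           then frechet_derivative (chart_map d \<circ> F \<circ> chart_inv c) (at (chart_map c p)) (v c)
           else 0))"

definition dir_deriv ::
  "('a, 'e::euclidean_space) manifold \<Rightarrow> 'a \<Rightarrow> ('a, 'e) tvec \<Rightarrow> ('a \<Rightarrow> real) \<Rightarrow> real" where
  "dir_deriv M p v f =
     (let c = some_chart M p in frechet_derivative (fun_in c f) (at (chart_map c p)) (v c))"

type_synonym ('a, 'e) vfield = "'a \<Rightarrow> ('a, 'e) tvec"

definition field_in :: "('a, 'e) chart \<Rightarrow> ('a, 'e) vfield \<Rightarrow> 'e \<Rightarrow> 'e" where
  "field_in c X u = X (chart_inv c u) c"

definition vector_field :: "('a, 'e::euclidean_space) manifold \<Rightarrow> ('a, 'e) vfield \<Rightarrow> bool" where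
  "vector_field M X \<longleftrightarrow>
     (\<forall>p\<in>points M. X p \<in> tangent_space M p) \<and>
     (\<forall>c\<in>atlas M. smooth_on (chart_range c) (field_in c X))"

type_synonym ('a, 'e) metric = "'a \<Rightarrow> ('a, 'e) tvec \<Rightarrow> ('a, 'e) tvec \<Rightarrow> real"

definition metric_in :: "('a, 'e::euclidean_space) manifold \<Rightarrow> ('a, 'e) metric \<Rightarrow>
    ('a, 'e) chart \<Rightarrow> 'e \<Rightarrow> 'e \<Rightarrow> 'e \<Rightarrow> real" where
  "metric_in M g c u x y =
     (let p = chart_inv c u in g p (coord_vec M c p x) (coord_vec M c p y))"

definition pseudo_riemannian ::
  "('a, 'e::euclidean_space) manifold \<Rightarrow> ('a, 'e) metric \<Rightarrow> bool" where
  "pseudo_riemannian M g \<longleftrightarrow>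
     smooth_manifold M \<and>
     (\<forall>p\<in>points M.
        (\<forall>v\<in>tangent_space M p. \<forall>w\<in>tangent_space M p. g p v w = g p w v) \<and>
        (\<forall>a b. \<forall>v\<in>tangent_space M p. \<forall>v'\<in>tangent_space M p. \<forall>w\<in>tangent_space M p.
           g p (\<lambda>c. a *\<^sub>R v c + b *\<^sub>R v' c) w = a * g p v w + b * g p v' w) \<and>
        (\<forall>v\<in>tangent_space M p. (\<forall>w\<in>tangent_space M p. g p v w = 0) \<longrightarrow> v = (\<lambda>c. 0))) \<and>
     (\<forall>c\<in>atlas M. \<forall>x y. smooth_on (chart_range c) (\<lambda>u. metric_in M g c u x y))"


section \<open>Tensor calculus on open subsets of a Euclidean space\<close>

(* Here h u x y is a metric given by its components: the point is u, the tangent vectors are x, y.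
   Vector fields are functions from points to vectors. *)

(* The Levi-Civita connection: the symmetry of \<Gamma> is the vanishing of the torsion, the second
   conjunct is the compatibility with the metric, both for constant vector fields. *)
definition christoffel ::
  "('e::euclidean_space \<Rightarrow> 'e \<Rightarrow> 'e \<Rightarrow> real) \<Rightarrow> 'e \<Rightarrow> 'e \<Rightarrow> 'e \<Rightarrow> 'e" where
  "christoffel h u = (THE \<Gamma>.
     (\<forall>x y. \<Gamma> x y = \<Gamma> y x) \<and>
     (\<forall>x y z. frechet_derivative (\<lambda>u. h u y z) (at u) x = h u (\<Gamma> x y) z + h u y (\<Gamma> x z)))"

definition cov :: "('e::euclidean_space \<Rightarrow> 'e \<Rightarrow> 'e \<Rightarrow> real) \<Rightarrow>
    ('e \<Rightarrow> 'e) \<Rightarrow> ('e \<Rightarrow> 'e) \<Rightarrow> 'e \<Rightarrow> 'e" where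
  "cov h X Y u = frechet_derivative Y (at u) (X u) + christoffel h u (X u) (Y u)"

definition bracket :: "('e::euclidean_space \<Rightarrow> 'e) \<Rightarrow> ('e \<Rightarrow> 'e) \<Rightarrow> 'e \<Rightarrow> 'e" where
  "bracket X Y u = frechet_derivative Y (at u) (X u) - frechet_derivative X (at u) (Y u)"

definition curvature :: "('e::euclidean_space \<Rightarrow> 'e \<Rightarrow> 'e \<Rightarrow> real) \<Rightarrow>
    ('e \<Rightarrow> 'e) \<Rightarrow> ('e \<Rightarrow> 'e) \<Rightarrow> ('e \<Rightarrow> 'e) \<Rightarrow> 'e \<Rightarrow> 'e" where
  "curvature h X Y Z u =
     cov h X (cov h Y Z) u - cov h Y (cov h X Z) u - cov h (bracket X Y) Z u"

definition lin_trace :: "('e::euclidean_space \<Rightarrow> 'e) \<Rightarrow> real" where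
  "lin_trace L = (\<Sum>b\<in>Basis. L b \<bullet> b)"

(* In the two definitions below the tensors are evaluated on constant extensions of the vectors. *)
definition ricci :: "('e::euclidean_space \<Rightarrow> 'e \<Rightarrow> 'e \<Rightarrow> real) \<Rightarrow> 'e \<Rightarrow> 'e \<Rightarrow> 'e \<Rightarrow> real" where
  "ricci h u y z = lin_trace (\<lambda>x. curvature h (\<lambda>_. x) (\<lambda>_. y) (\<lambda>_. z) u)"

definition lie_metric :: "('e::euclidean_space \<Rightarrow> 'e \<Rightarrow> 'e \<Rightarrow> real) \<Rightarrow>
    ('e \<Rightarrow> 'e) \<Rightarrow> 'e \<Rightarrow> 'e \<Rightarrow> 'e \<Rightarrow> real" where
  "lie_metric h X u y z =
     frechet_derivative (\<lambda>u. h u y z) (at u) (X u)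
       - h u (bracket X (\<lambda>_. y) u) z - h u y (bracket X (\<lambda>_. z) u)"

definition metric_trace :: "('e::euclidean_space \<Rightarrow> 'e \<Rightarrow> 'e \<Rightarrow> real) \<Rightarrow>
    'e \<Rightarrow> ('e \<Rightarrow> 'e \<Rightarrow> real) \<Rightarrow> real" where
  "metric_trace h u B = lin_trace (\<lambda>x. THE z. \<forall>y. h u z y = B x y)"


section \<open>Pseudo-Riemannian geometry and Ricci solitons\<close>

definition cov_deriv :: "('a, 'e::euclidean_space) manifold \<Rightarrow> ('a, 'e) metric \<Rightarrow>
    ('a, 'e) vfield \<Rightarrow> ('a, 'e) vfield \<Rightarrow> ('a, 'e) vfield" where
  "cov_deriv M g X Y p =
     (\<lambda>c. if c \<in> charts_at M p
          then cov (metric_in M g c) (field_in c X) (field_in c Y) (chart_map c p) else 0)"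

definition gradient :: "('a, 'e::euclidean_space) manifold \<Rightarrow> ('a, 'e) metric \<Rightarrow>
    ('a \<Rightarrow> real) \<Rightarrow> ('a, 'e) vfield" where
  "gradient M g f p =
     (THE v. v \<in> tangent_space M p \<and> (\<forall>w\<in>tangent_space M p. g p v w = dir_deriv M p w f))"

definition hessian_in :: "('a, 'e::euclidean_space) manifold \<Rightarrow> ('a, 'e) metric \<Rightarrow>
    ('a \<Rightarrow> real) \<Rightarrow> ('a, 'e) chart \<Rightarrow> 'e \<Rightarrow> 'e \<Rightarrow> 'e \<Rightarrow> real" where
  "hessian_in M g f c u x y =
     metric_in M g c u (cov (metric_in M g c) (\<lambda>_. x) (field_in c (gradient M g f)) u) y"

(* The value does not depend on the chart, the Hessian being a tensor field. *)
definition laplacian :: "('a, 'e::euclidean_space) manifold \<Rightarrow> ('a, 'e) metric \<Rightarrow>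
    ('a \<Rightarrow> real) \<Rightarrow> 'a \<Rightarrow> real" where
  "laplacian M g f p =
     (let c = some_chart M p; u = chart_map c p in
      metric_trace (metric_in M g c) u (hessian_in M g f c u))"

definition f_sharp :: "nat \<Rightarrow> ('a, 'e::euclidean_space) manifold \<Rightarrow> ('a, 'e) metric \<Rightarrow>
    ('a \<Rightarrow> real) \<Rightarrow> 'a \<Rightarrow> real" where
  "f_sharp n M g f p =
     f p * laplacian M g f p + (real n - 1) * g p (gradient M g f p) (gradient M g f p)"

(* Both sides are tensor fields; their values at p are compared on all pairs of tangent vectors,
   with the left-hand side computed in any chart c around p. *)
definition ricci_soliton :: "('a, 'e::euclidean_space) manifold \<Rightarrow> ('a, 'e) metric \<Rightarrow>
    ('a, 'e) vfield \<Rightarrow> real \<Rightarrow> bool" where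
  "ricci_soliton M g \<xi> l \<longleftrightarrow>
     pseudo_riemannian M g \<and> vector_field M \<xi> \<and>
     (\<forall>p\<in>points M. \<forall>c\<in>charts_at M p. \<forall>v\<in>tangent_space M p. \<forall>w\<in>tangent_space M p.
        1/2 * lie_metric (metric_in M g c) (field_in c \<xi>) (chart_map c p) (v c) (w c)
          + ricci (metric_in M g c) (chart_map c p) (v c) (w c) = l * g p v w)"


section \<open>Warped products\<close>

definition prod_chart :: "('a, 'e) chart \<Rightarrow> ('b, 'f) chart \<Rightarrow> ('a \<times> 'b, 'e \<times> 'f) chart" where
  "prod_chart c d =
     Chart (chart_dom c \<times> chart_dom d) (map_prod (chart_map c) (chart_map d))"

definition prod_manifold :: "('a, 'e) manifold \<Rightarrow> ('b, 'f) manifold \<Rightarrow>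
    ('a \<times> 'b, 'e \<times> 'f) manifold" where
  "prod_manifold M N =
     \<lparr>topo = prod_topology (topo M) (topo N),
      atlas = {prod_chart c d |c d. c \<in> atlas M \<and> d \<in> atlas N}\<rparr>"

definition pullback :: "('a, 'e::euclidean_space) manifold \<Rightarrow> ('b, 'f::euclidean_space) manifold \<Rightarrow>
    ('a \<Rightarrow> 'b) \<Rightarrow> ('b, 'f) metric \<Rightarrow> ('a, 'e) metric" where
  "pullback M N F g p v w = g (F p) (tangent_map M N F p v) (tangent_map M N F p w)"

definition warped_metric :: "('a, 'e::euclidean_space) manifold \<Rightarrow> ('a, 'e) metric \<Rightarrow>
    ('a \<Rightarrow> real) \<Rightarrow> ('b, 'f::euclidean_space) manifold \<Rightarrow> ('b, 'f) metric \<Rightarrow>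
    ('a \<times> 'b, 'e \<times> 'f) metric" where
  "warped_metric M1 g1 f M2 g2 m v w =
     pullback (prod_manifold M1 M2) M1 fst g1 m v w
       + (f (fst m))\<^sup>2 * pullback (prod_manifold M1 M2) M2 snd g2 m v w"

definition lift1 :: "('a, 'e::euclidean_space) manifold \<Rightarrow> ('b, 'f::euclidean_space) manifold \<Rightarrow>
    ('a, 'e) vfield \<Rightarrow> ('a \<times> 'b, 'e \<times> 'f) vfield" where
  "lift1 M1 M2 X m =
     tangent_map M1 (prod_manifold M1 M2) (\<lambda>p. (p, snd m)) (fst m) (X (fst m))"

definition lift2 :: "('a, 'e::euclidean_space) manifold \<Rightarrow> ('b, 'f::euclidean_space) manifold \<Rightarrow>
    ('b, 'f) vfield \<Rightarrow> ('a \<times> 'b, 'e \<times> 'f) vfield" where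
  "lift2 M1 M2 Y m =
     tangent_map M2 (prod_manifold M1 M2) (\<lambda>q. (fst m, q)) (snd m) (Y (snd m))"

end

theory Submission
  imports Defs
begin

text \<open>In a product chart, with \<open>\<phi>\<close> the coordinate form of \<open>f\<close> and \<open>G\<close> that of its gradient, the
  Christoffel symbols of the warped metric are
  \<open>\<Gamma> ((x, y), (x', y')) = (\<Gamma>1 (x, x') - \<phi> h2 (y, y') G, \<Gamma>2 (y, y') + (d\<phi> x / \<phi>) y' + (d\<phi> x' / \<phi>) y)\<close>.
  Hence on vectors tangent to \<open>M1\<close> the Ricci tensor is \<open>Ric1 - (n2 / f) Hess f\<close>, and on vectors tangent
  to \<open>M2\<close> it is \<open>Ric2 - f_sharp g2\<close>; likewise the Lie derivative of the warped metric restricts to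
  \<open>L1 g1\<close> and to \<open>2 f \<zeta>1(f) g2 + f^2 L2 g2\<close>. Restricting the soliton equation to the second kind of vectors
  gives (2). Restricting it to the first kind gives (1): since the Hessian is symmetric, the condition on
  \<open>\<eta>1\<close> says that half the Lie derivative of \<open>g1\<close> along \<open>\<eta>1\<close> is \<open>(n2 / f) Hess f\<close>. That condition is only
  about global vector fields, so a bump function is needed to reach every tangent vector.\<close>

section \<open>Closure properties of smooth maps\<close>

text \<open>\<open>christoffel\<close> and \<open>gradient\<close> are definite descriptions, so
  neither linearity nor differentiability comes with them, yet the curvature differentiates
  \<open>\<Gamma>\<close> and the Hessian differentiates the gradient. Both are solutions s of h(s,
  z) = (known function of z) with h nondegenerate, and such solutions inherit differentiability from
  the data. The warped \<open>\<Gamma>\<close> is not computed from the Koszul formula: the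
  displayed expression is checked to be symmetric and metric, and uniqueness does the rest. In
  \<open>f_sharp\<close>, the term with the Laplacian is the trace of the curvature over base
  directions. The factor n2 - 1 comes from the fibre directions: the trace of x -> h2(y, z) x -
  h2(x, z) y is (n2 - 1) h2(y, z). Several notions are evaluated in a chart picked by choice
  (\<open>some_chart\<close>), which need not be the chart of the computation; the chain rule for
  transition maps closes this gap each time.\<close>

lemma has_frechet_derivative:
  "f differentiable (at x) \<Longrightarrow> (f has_derivative frechet_derivative f (at x)) (at x)"
  using frechet_derivative_works by blast

lemma frechet_derivative_eqI:
  "(f has_derivative f') (at x) \<Longrightarrow> frechet_derivative f (at x) = f'"
  using frechet_derivative_at by metis

text \<open>Differentiability is not assumed: \<open>frechet_derivative\<close> is a choice over the
  predicate \<open>has_derivative\<close>, and that predicate is the same for both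
  functions.\<close>

lemma frechet_derivative_cong_open:
  assumes "open S" "x \<in> S" "\<And>y. y \<in> S \<Longrightarrow> f y = g y"
  shows "frechet_derivative f (at x) = frechet_derivative g (at x)"
proof -
  have "(f has_derivative D) (at x) \<longleftrightarrow> (g has_derivative D) (at x)" for D
    using assms has_derivative_transform_within_open[of f D x UNIV S g]
      has_derivative_transform_within_open[of g D x UNIV S f] by auto
  then show ?thesis unfolding frechet_derivative_def by simp
qed

lemma Ck_on_cong:
  assumes "open S" "\<And>x. x \<in> S \<Longrightarrow> f x = g x" "Ck_on k S f"
  shows "Ck_on k S g"
  using assms(2,3)
proof (induction k arbitrary: f g)
  case 0
  then show ?case by (simp cong: continuous_on_cong)
next
  case (Suc k)
  have "g differentiable (at x)" if "x \<in> S" for x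
  proof -
    have "(f has_derivative frechet_derivative f (at x)) (at x)"
      using Suc.prems(2) that by (simp add: has_frechet_derivative)
    then have "(g has_derivative frechet_derivative f (at x)) (at x)"
      by (rule has_derivative_transform_within_open[OF _ assms(1) that]) (use Suc.prems(1) in auto)
    then show ?thesis by (auto simp: differentiable_def)
  qed
  moreover have "Ck_on k S (\<lambda>x. frechet_derivative g (at x) v)" for v
    by (rule Suc.IH[of "\<lambda>x. frechet_derivative f (at x) v"])
       (use Suc.prems assms(1) frechet_derivative_cong_open[of S _ f g] in auto)
  ultimately show ?case by simp
qed

lemma Ck_on_imp_continuous_on: "Ck_on k S f \<Longrightarrow> continuous_on S f"
  by (cases k) (auto intro!: continuous_at_imp_continuous_on differentiable_imp_continuous_within)

lemma Ck_on_Suc_imp: "Ck_on (Suc k) S f \<Longrightarrow> Ck_on k S f"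
proof (induction k arbitrary: f)
  case 0
  then show ?case using Ck_on_imp_continuous_on by (metis Ck_on.simps(1))
next
  case (Suc k)
  then show ?case by (metis Ck_on.simps(2))
qed

lemma Ck_on_Un:
  assumes "open S" "open T" "Ck_on k S f" "Ck_on k T f"
  shows "Ck_on k (S \<union> T) f"
  using assms(3,4)
  by (induction k arbitrary: f) (auto intro: continuous_on_open_Un assms(1,2))

lemma Ck_on_const [simp]: "Ck_on k S (\<lambda>x. c)"
  by (induction k arbitrary: c) auto

lemma Ck_on_SucI:
  assumes "open S" "\<And>x. x \<in> S \<Longrightarrow> (f has_derivative f' x) (at x)" "\<And>v. Ck_on k S (\<lambda>x. f' x v)"
  shows "Ck_on (Suc k) S f"
proof -
  have "Ck_on k S (\<lambda>x. frechet_derivative f (at x) v)" for v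
    by (rule Ck_on_cong[OF assms(1) _ assms(3)[of v]]) (simp add: frechet_derivative_eqI[OF assms(2)])
  then show ?thesis using assms(2) by (auto simp: differentiable_def)
qed

lemma Ck_on_SucD:
  assumes "Ck_on (Suc k) S f" "x \<in> S"
  shows "(f has_derivative frechet_derivative f (at x)) (at x)"
  using assms by (auto intro: has_frechet_derivative)

lemma Ck_on_bounded_linear:
  assumes "open S" "bounded_linear L"
  shows "Ck_on k S L"
proof (cases k)
  case 0
  then show ?thesis using assms by (auto intro: linear_continuous_on)
next
  case (Suc n)
  have "(L has_derivative L) (at x)" for x using assms by (simp add: bounded_linear_imp_has_derivative)
  then show ?thesis unfolding Suc using assms by (intro Ck_on_SucI[where f' = "\<lambda>_. L"]) auto
qed

lemma Ck_on_linear_comp: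
  assumes "open S" "bounded_linear L" "Ck_on k S f"
  shows "Ck_on k S (\<lambda>x. L (f x))"
  using assms(3)
proof (induction k arbitrary: f)
  case 0
  then show ?case using assms(2) by (auto intro: bounded_linear.continuous_on)
next
  case (Suc k)
  show ?case
    by (rule Ck_on_SucI[OF assms(1) bounded_linear.has_derivative[OF assms(2) Ck_on_SucD[OF Suc.prems]]])
       (use Suc in auto)
qed

lemma Ck_on_add:
  assumes "open S" "Ck_on k S f" "Ck_on k S g"
  shows "Ck_on k S (\<lambda>x. f x + g x)"
  using assms(2,3)
proof (induction k arbitrary: f g)
  case 0
  then show ?case by (auto intro: continuous_on_add)
next
  case (Suc k)
  show ?case
    by (rule Ck_on_SucI[OF assms(1) has_derivative_add[OF Ck_on_SucD[OF Suc.prems(1)] Ck_on_SucD[OF Suc.prems(2)]]])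
       (use Suc in auto)
qed

lemma Ck_on_sum:
  assumes "open S" "\<And>i. i \<in> I \<Longrightarrow> Ck_on k S (f i)"
  shows "Ck_on k S (\<lambda>x. \<Sum>i\<in>I. f i x)"
  using assms(2) by (induction I rule: infinite_finite_induct) (auto intro: Ck_on_add[OF assms(1)])

text \<open>By the product rule the derivative is a sum of two terms of the same shape. In each of
  them one factor is undifferentiated and has one order of smoothness to spare, which
  \<open>Ck_on_Suc_imp\<close> gives up.\<close>

lemma Ck_on_bilinear:
  assumes "open S" "bounded_bilinear B" "Ck_on k S f" "Ck_on k S g"
  shows "Ck_on k S (\<lambda>x. B (f x) (g x))"
  using assms(3,4)
proof (induction k arbitrary: f g)
  case 0
  then show ?case using assms(2) by (auto intro: bounded_bilinear.continuous_on)
next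
  case (Suc k)
  show ?case
    by (rule Ck_on_SucI[OF assms(1) bounded_bilinear.FDERIV[OF assms(2) Ck_on_SucD[OF Suc.prems(1)] Ck_on_SucD[OF Suc.prems(2)]]])
       (use Suc Ck_on_Suc_imp[OF Suc.prems(1)] Ck_on_Suc_imp[OF Suc.prems(2)]
         in \<open>auto intro!: Ck_on_add[OF assms(1)]\<close>)
qed

lemmas Ck_on_scaleR = Ck_on_bilinear[OF _ bounded_bilinear_scaleR]

lemma Ck_on_compose:
  fixes f :: "'a::euclidean_space \<Rightarrow> 'b::euclidean_space"
    and g :: "'b \<Rightarrow> 'c::real_normed_vector"
  assumes "open S" "open T" "f ` S \<subseteq> T" "Ck_on k S f" "Ck_on k T g"
  shows "Ck_on k S (\<lambda>x. g (f x))"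
  using assms(4,5)
proof (induction k arbitrary: g)
  case 0
  then show ?case using assms(3) by (auto intro: continuous_on_compose2)
next
  case (Suc k)
  have D: "((\<lambda>x. g (f x)) has_derivative
      (\<lambda>v. frechet_derivative g (at (f x)) (frechet_derivative f (at x) v))) (at x)" if "x \<in> S" for x
    using has_derivative_compose[OF Ck_on_SucD[OF Suc.prems(1)] Ck_on_SucD[OF Suc.prems(2)], of x] that assms(3)
    by auto
  \<comment> \<open>In the chain rule the direction fed to the derivative of \<open>g\<close> varies
    with x, whereas \<open>Ck_on\<close> speaks of fixed directions only. Expanding in the basis
    leaves fixed directions with variable scalar coefficients.\<close>
  have expand: "frechet_derivative g (at (f x)) (frechet_derivative f (at x) v) =
     (\<Sum>b\<in>Basis. (frechet_derivative f (at x) v \<bullet> b) *\<^sub>R frechet_derivative g (at (f x)) b)"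
    if "x \<in> S" for x v
  proof -
    have "linear (frechet_derivative g (at (f x)))"
      using Suc.prems(2) assms(3) that by (auto intro: linear_frechet_derivative)
    then have "frechet_derivative g (at (f x)) (\<Sum>b\<in>Basis. (frechet_derivative f (at x) v \<bullet> b) *\<^sub>R b) =
      (\<Sum>b\<in>Basis. (frechet_derivative f (at x) v \<bullet> b) *\<^sub>R frechet_derivative g (at (f x)) b)"
      by (simp add: linear_sum linear_cmul o_def)
    then show ?thesis by (simp add: euclidean_representation)
  qed
  show ?case
  proof (rule Ck_on_SucI[OF assms(1) D])
    fix v
    have "Ck_on k S (\<lambda>x. \<Sum>b\<in>Basis. (frechet_derivative f (at x) v \<bullet> b) *\<^sub>R frechet_derivative g (at (f x)) b)"
      using Suc.prems Ck_on_Suc_imp[OF Suc.prems(1)]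
      by (intro Ck_on_sum Ck_on_scaleR Ck_on_linear_comp[OF _ bounded_linear_inner_left] assms(1)
          Suc.IH[of "\<lambda>y. frechet_derivative g (at y) _"]) auto
    then show "Ck_on k S (\<lambda>x. frechet_derivative g (at (f x)) (frechet_derivative f (at x) v))"
      by (rule Ck_on_cong[OF assms(1) _, rotated]) (simp add: expand)
  qed auto
qed

subsection \<open>A smooth bump function\<close>

text \<open>The classical flat function exp(-1/t) is the case n = 0. The powers of 1/t are included
  because the family then contains, up to linear combinations, all derivatives of its
  members.\<close>

definition flat :: "nat \<Rightarrow> real \<Rightarrow> real" where
  "flat n t = (if t > 0 then inverse t ^ n * exp (- inverse t) else 0)"

text \<open>With s = 1/t the claim from the right is that s^n / exp s tends to 0 as s grows.\<close>

lemma flat_tendsto_0: "(flat n \<longlongrightarrow> 0) (at 0)"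
proof -
  have "((\<lambda>t::real. inverse t ^ n / exp (inverse t)) \<longlongrightarrow> 0) (at_right 0)"
    using filterlim_compose[OF tendsto_power_div_exp_0 filterlim_inverse_at_top_right] .
  then have "(flat n \<longlongrightarrow> 0) (at_right 0)"
    by (rule Lim_transform_eventually)
       (auto simp: flat_def exp_minus divide_inverse eventually_at_filter)
  moreover have "(flat n \<longlongrightarrow> 0) (at_left 0)"
    by (rule Lim_transform_eventually[OF tendsto_const])
       (auto simp: flat_def eventually_at_filter)
  ultimately show ?thesis by (simp add: filterlim_split_at)
qed

lemma flat_has_field_derivative:
  "(flat n has_field_derivative (flat (n + 2) t - real n * flat (n + 1) t)) (at t)"
proof -
  consider "t > 0" | "t < 0" | "t = 0" by linarith
  then show ?thesis
  proof cases
    case 1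
    have "((\<lambda>t. inverse t ^ n * exp (- inverse t)) has_field_derivative
       (flat (n + 2) t - real n * flat (n + 1) t)) (at t)"
      using 1 by (auto intro!: derivative_eq_intros simp: flat_def field_simps power_Suc)
          (cases n; simp add: field_simps)
    then show ?thesis
      by (rule DERIV_cong_ev[THEN iffD1, rotated -1, OF _ refl _ refl])
         (use 1 in \<open>auto simp: flat_def intro!: eventually_mono[OF eventually_nhds_in_open[of "{0<..}" t]]\<close>)
  next
    case 2
    have "((\<lambda>t. 0) has_field_derivative (flat (n + 2) t - real n * flat (n + 1) t)) (at t)"
      using 2 by (auto simp: flat_def)
    then show ?thesis
      by (rule DERIV_cong_ev[THEN iffD1, rotated -1, OF _ refl _ refl])
         (use 2 in \<open>auto simp: flat_def intro!: eventually_mono[OF eventually_nhds_in_open[of "{..<0}" t]]\<close>)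
  next
    case 3
    \<comment> \<open>The difference quotient of \<open>flat n\<close> at 0 is
      \<open>flat (Suc n)\<close> itself, which tends to 0.\<close>
    have "((\<lambda>h. (flat n (0 + h) - flat n 0) / h) \<longlongrightarrow> 0) (at 0)"
      by (rule Lim_transform_eventually[OF flat_tendsto_0[of "Suc n"]])
         (auto simp: flat_def field_simps eventually_at_filter)
    then show ?thesis using 3 by (simp add: DERIV_def flat_def)
  qed
qed

lemma Ck_on_flat: "Ck_on k UNIV (flat n)"
proof (induction k arbitrary: n)
  case 0
  have "isCont (flat n) t" for t by (rule DERIV_isCont[OF flat_has_field_derivative])
  then show ?case by (auto intro!: continuous_at_imp_continuous_on)
next
  case (Suc k)
  show ?case
  proof (rule Ck_on_SucI)
    show "(flat n has_derivative (\<lambda>v. (flat (n + 2) t - real n * flat (n + 1) t) * v)) (at t)" for t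
      using flat_has_field_derivative[of n t] unfolding has_field_derivative_def .
    show "Ck_on k UNIV (\<lambda>t. (flat (n + 2) t - real n * flat (n + 1) t) * v)" for v
    proof -
      have "Ck_on k UNIV (\<lambda>t. v *\<^sub>R flat (n + 2) t + (- v * real n) *\<^sub>R flat (n + 1) t)"
        by (intro Ck_on_add[OF open_UNIV] Ck_on_linear_comp[OF open_UNIV bounded_linear_scaleR_right] Suc.IH)
      then show ?thesis by (simp add: algebra_simps)
    qed
  qed auto
qed

lemma smooth_bump:
  fixes a :: "'e::euclidean_space"
  assumes "r > 0"
  obtains \<psi> :: "'e \<Rightarrow> real" where "\<And>k. Ck_on k UNIV \<psi>" "\<psi> a = 1" "\<And>x. x \<notin> cball a r \<Longrightarrow> \<psi> x = 0"
proof
  \<comment> \<open>The argument r^2 - |x - a|^2 is not positive outside the ball, where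
    \<open>flat 0\<close> is 0; the first factor normalises the value at a to 1. The sums and
    scalings are spelled out so that the closure rules for \<open>Ck_on\<close> match.\<close>
  define \<psi> where "\<psi> x = inverse (flat 0 (r\<^sup>2)) *\<^sub>R flat 0 (r\<^sup>2 + (-1) *\<^sub>R ((x + - a) \<bullet> (x + - a)))" for x :: 'e
  have id: "Ck_on k UNIV (\<lambda>x::'e. x)" for k by (intro Ck_on_bounded_linear bounded_linear_ident open_UNIV)
  show "Ck_on k UNIV \<psi>" for k
    unfolding \<psi>_def
    by (intro Ck_on_linear_comp[OF open_UNIV bounded_linear_scaleR_right] Ck_on_compose[OF open_UNIV open_UNIV _ _ Ck_on_flat]
        Ck_on_add[OF open_UNIV] Ck_on_bilinear[OF open_UNIV bounded_bilinear_inner] Ck_on_const id subset_UNIV)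
  show "\<psi> a = 1" using assms by (simp add: \<psi>_def flat_def)
  show "\<psi> x = 0" if "x \<notin> cball a r" for x
  proof -
    have "r\<^sup>2 \<le> (x - a) \<bullet> (x - a)"
      using that assms power_mono[of r "norm (x - a)" 2]
      by (simp add: dist_norm norm_minus_commute[of a] power2_norm_eq_inner)
    then show ?thesis by (simp add: \<psi>_def flat_def)
  qed
qed

section \<open>Symmetry of second derivatives\<close>

text \<open>Two applications of the mean value theorem, in direction x and then in direction y, turn
  the quotient into the exact value of \<open>D2\<close> at a nearby point; continuity gives the
  limit. The quotient is symmetric in x and y, which is what
  \<open>second_derivative_symmetric\<close> exploits.\<close>

lemma double_difference_quotient_tendsto:
  fixes f :: "'e::euclidean_space \<Rightarrow> real"
  assumes "open U" "u \<in> U"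
    and D: "\<And>w. w \<in> U \<Longrightarrow> (f has_derivative Df w) (at w)"
    and D2: "\<And>w. w \<in> U \<Longrightarrow> ((\<lambda>w. Df w x) has_derivative D2 w) (at w)"
    and cont: "continuous_on U (\<lambda>w. D2 w y)"
  shows "((\<lambda>t. (f (u + t *\<^sub>R x + t *\<^sub>R y) - f (u + t *\<^sub>R x) - f (u + t *\<^sub>R y) + f u) / t\<^sup>2)
           \<longlongrightarrow> D2 u y) (at_right 0)"
proof (rule tendstoI)
  fix e :: real assume "e > 0"
  obtain r where r: "r > 0" "ball u r \<subseteq> U" using assms(1,2) openE by blast
  obtain \<delta> where \<delta>: "\<delta> > 0" "\<And>w. w \<in> U \<Longrightarrow> dist w u < \<delta> \<Longrightarrow> dist (D2 w y) (D2 u y) < e"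
    using cont assms(2) \<open>e > 0\<close> unfolding continuous_on_iff by metis
  \<comment> \<open>Chosen so that every point u + s x + s' y with s and s' in [0, t] and t < d is
    closer to u than both r and \<open>\<delta>\<close>. The summand 1 keeps the denominator
    positive when x = y = 0.\<close>
  define d where "d = min r \<delta> / (norm x + norm y + 1)"
  have "d > 0" using r \<delta> by (auto simp: d_def intro!: divide_pos_pos add_nonneg_pos)
  have close: "dist (u + s *\<^sub>R x + s' *\<^sub>R y) u < min r \<delta>"
    if "0 \<le> s" "s \<le> t" "0 \<le> s'" "s' \<le> t" "t < d" for s s' t
  proof -
    have "norm (s *\<^sub>R x + s' *\<^sub>R y) \<le> s * norm x + s' * norm y"
      using norm_triangle_ineq[of "s *\<^sub>R x" "s' *\<^sub>R y"] that by simp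
    also have "\<dots> \<le> t * norm x + t * norm y" using that by (intro add_mono mult_right_mono) auto
    also have "\<dots> \<le> t * (norm x + norm y + 1)" using that by (simp add: algebra_simps)
    also have "\<dots> < d * (norm x + norm y + 1)" using that by (intro mult_strict_right_mono) (auto intro: add_nonneg_pos)
    also have "\<dots> = min r \<delta>" unfolding d_def
      by (metis add_nonneg_pos add_nonneg_nonneg norm_ge_zero zero_less_one less_numeral_extra(3) nonzero_eq_divide_eq)
    finally show ?thesis by (simp add: dist_norm add.assoc)
  qed
  have U: "u + s *\<^sub>R x + s' *\<^sub>R y \<in> U" if "0 \<le> s" "s \<le> t" "0 \<le> s'" "s' \<le> t" "t < d" for s s' t
    using close[OF that] r by (auto simp: dist_commute)
  have Dx: "((\<lambda>s. f (u + s *\<^sub>R x + s' *\<^sub>R y)) has_real_derivative Df (u + s *\<^sub>R x + s' *\<^sub>R y) x) (at s)"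
    if "0 \<le> s" "s \<le> t" "0 \<le> s'" "s' \<le> t" "t < d" for s s' t
  proof -
    have "((\<lambda>s. u + s *\<^sub>R x + s' *\<^sub>R y) has_derivative (\<lambda>ds. ds *\<^sub>R x)) (at s)"
      by (auto intro!: derivative_eq_intros)
    from has_derivative_compose[OF this D[OF U[OF that]]]
    have "((\<lambda>s. f (u + s *\<^sub>R x + s' *\<^sub>R y)) has_derivative (\<lambda>ds. Df (u + s *\<^sub>R x + s' *\<^sub>R y) (ds *\<^sub>R x))) (at s)" .
    then show ?thesis
      using linear_cmul[OF has_derivative_linear[OF D[OF U[OF that]]]]
      by (simp add: has_field_derivative_def mult_commute_abs)
  qed
  have Dy: "((\<lambda>s'. Df (u + s *\<^sub>R x + s' *\<^sub>R y) x) has_real_derivative D2 (u + s *\<^sub>R x + s' *\<^sub>R y) y) (at s')"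
    if "0 \<le> s" "s \<le> t" "0 \<le> s'" "s' \<le> t" "t < d" for s s' t
  proof -
    have "((\<lambda>s'. u + s *\<^sub>R x + s' *\<^sub>R y) has_derivative (\<lambda>ds. ds *\<^sub>R y)) (at s')"
      by (auto intro!: derivative_eq_intros)
    from has_derivative_compose[OF this D2[OF U[OF that]]]
    have "((\<lambda>s'. Df (u + s *\<^sub>R x + s' *\<^sub>R y) x) has_derivative (\<lambda>ds. D2 (u + s *\<^sub>R x + s' *\<^sub>R y) (ds *\<^sub>R y))) (at s')" .
    then show ?thesis
      using linear_cmul[OF has_derivative_linear[OF D2[OF U[OF that]]]]
      by (simp add: has_field_derivative_def mult_commute_abs)
  qed
  have "dist ((f (u + t *\<^sub>R x + t *\<^sub>R y) - f (u + t *\<^sub>R x) - f (u + t *\<^sub>R y) + f u) / t\<^sup>2) (D2 u y) < e"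
    if t: "0 < t" "t < d" for t
  proof -
    \<comment> \<open>Mean value theorem for the difference of f along two parallel segments in
      direction x, displaced by t y; the terms with factor 0 keep both in the shape that
      \<open>Dx\<close> covers.\<close>
    obtain \<sigma> where \<sigma>: "0 < \<sigma>" "\<sigma> < t"
      "(f (u + t *\<^sub>R x + t *\<^sub>R y) - f (u + t *\<^sub>R x + 0 *\<^sub>R y)) - (f (u + 0 *\<^sub>R x + t *\<^sub>R y) - f (u + 0 *\<^sub>R x + 0 *\<^sub>R y))
        = (t - 0) * (Df (u + \<sigma> *\<^sub>R x + t *\<^sub>R y) x - Df (u + \<sigma> *\<^sub>R x + 0 *\<^sub>R y) x)"
    proof (rule exE[OF MVT2[OF t(1)]])
      show "((\<lambda>s. f (u + s *\<^sub>R x + t *\<^sub>R y) - f (u + s *\<^sub>R x + 0 *\<^sub>R y)) has_real_derivative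
         (Df (u + s *\<^sub>R x + t *\<^sub>R y) x - Df (u + s *\<^sub>R x + 0 *\<^sub>R y) x)) (at s)" if "0 \<le> s" "s \<le> t" for s
        using that t by (intro DERIV_diff Dx[of _ t]) auto
    qed (use that in blast)
    obtain \<tau> where \<tau>: "0 < \<tau>" "\<tau> < t"
      "Df (u + \<sigma> *\<^sub>R x + t *\<^sub>R y) x - Df (u + \<sigma> *\<^sub>R x + 0 *\<^sub>R y) x = (t - 0) * D2 (u + \<sigma> *\<^sub>R x + \<tau> *\<^sub>R y) y"
      using MVT2[OF t(1), of "\<lambda>s'. Df (u + \<sigma> *\<^sub>R x + s' *\<^sub>R y) x" "\<lambda>s'. D2 (u + \<sigma> *\<^sub>R x + s' *\<^sub>R y) y"]
        Dy[of \<sigma> t] \<sigma>(1,2) t by (meson less_imp_le)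
    have "(f (u + t *\<^sub>R x + t *\<^sub>R y) - f (u + t *\<^sub>R x) - f (u + t *\<^sub>R y) + f u) / t\<^sup>2 = D2 (u + \<sigma> *\<^sub>R x + \<tau> *\<^sub>R y) y"
      using \<sigma>(3) \<tau>(3) t by (simp add: field_simps power2_eq_square)
    moreover have "dist (D2 (u + \<sigma> *\<^sub>R x + \<tau> *\<^sub>R y) y) (D2 u y) < e"
      using close[of \<sigma> t \<tau>] U[of \<sigma> t \<tau>] \<sigma> \<tau> t by (intro \<delta>(2)) auto
    ultimately show ?thesis by simp
  qed
  then show "\<forall>\<^sub>F t in at_right 0. dist ((f (u + t *\<^sub>R x + t *\<^sub>R y) - f (u + t *\<^sub>R x) - f (u + t *\<^sub>R y) + f u) / t\<^sup>2) (D2 u y) < e"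
    using \<open>d > 0\<close> unfolding eventually_at_right_field by blast
qed

lemma second_derivative_symmetric:
  fixes f :: "'e::euclidean_space \<Rightarrow> real"
  assumes "open U" "u \<in> U" "Ck_on 2 U f"
  shows "frechet_derivative (\<lambda>w. frechet_derivative f (at w) x) (at u) y =
         frechet_derivative (\<lambda>w. frechet_derivative f (at w) y) (at u) x"
proof -
  have C: "Ck_on (Suc (Suc 0)) U f" using assms(3) by (simp add: numeral_2_eq_2)
  have C': "Ck_on (Suc 0) U (\<lambda>w. frechet_derivative f (at w) v)" for v
    using C Ck_on.simps(2) by blast
  have "((\<lambda>t. (f (u + t *\<^sub>R x + t *\<^sub>R y) - f (u + t *\<^sub>R x) - f (u + t *\<^sub>R y) + f u) / t\<^sup>2)
           \<longlongrightarrow> frechet_derivative (\<lambda>w. frechet_derivative f (at w) x) (at u) y) (at_right 0)" for x y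
    using C' by (intro double_difference_quotient_tendsto[OF assms(1,2) Ck_on_SucD[OF C] Ck_on_SucD[OF C']]) auto
  from this[of x y] this[of y x] show ?thesis
    by (intro tendsto_unique[OF trivial_limit_at_right_real]) (simp_all add: algebra_simps)
qed

section \<open>Nondegenerate bilinear forms\<close>

text \<open>The vector that represents the functional \<open>B v\<close> through the Euclidean inner
  product. Nondegeneracy of B becomes injectivity of a linear endomorphism, hence
  bijectivity.\<close>

definition gram :: "('e::euclidean_space \<Rightarrow> 'e \<Rightarrow> real) \<Rightarrow> 'e \<Rightarrow> 'e" where
  "gram B v = (\<Sum>b\<in>Basis. B v b *\<^sub>R b)"

lemma linear_gram: "bilinear B \<Longrightarrow> linear (gram B)"
  by (rule linearI)
     (auto simp: gram_def bilinear_ladd bilinear_lmul scaleR_add_left sum.distrib scaleR_sum_right)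

lemma inner_gram:
  assumes "bilinear B" shows "gram B v \<bullet> w = B v w"
proof -
  have "B v w = B v (\<Sum>b\<in>Basis. (w \<bullet> b) *\<^sub>R b)" by (simp add: euclidean_representation)
  also have "\<dots> = (\<Sum>b\<in>Basis. (w \<bullet> b) * B v b)"
    using assms by (simp add: linear_sum[of "B v"] linear_cmul[of "B v"] bilinear_def)
  finally show ?thesis by (simp add: gram_def inner_sum_left inner_commute[of w] mult.commute)
qed

lemma inj_gram:
  assumes "bilinear B" "\<And>v. (\<And>w. B v w = 0) \<Longrightarrow> v = 0"
  shows "inj (gram B)"
  unfolding linear_injective_0[OF linear_gram[OF assms(1)]]
  using assms inner_gram by (metis inner_zero_left)

lemma nondegenerate_represent:
  fixes B :: "'e::euclidean_space \<Rightarrow> 'e \<Rightarrow> real"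
  assumes "bilinear B" "\<And>v. (\<And>w. B v w = 0) \<Longrightarrow> v = 0" "linear l"
  shows "\<exists>v. \<forall>w. B v w = l w"
proof -
  obtain v where "gram B v = (\<Sum>b\<in>Basis. l b *\<^sub>R b)"
    using linear_injective_imp_surjective[OF linear_gram[OF assms(1)] inj_gram[OF assms(1,2)]] by (metis surjD)
  then have "B v w = (\<Sum>b\<in>Basis. l b *\<^sub>R b) \<bullet> w" for w using inner_gram[OF assms(1)] by metis
  also have "\<dots> w = l (\<Sum>b\<in>Basis. (w \<bullet> b) *\<^sub>R b)" for w
    by (simp add: linear_sum[OF assms(3)] linear_cmul[OF assms(3)] inner_sum_left inner_commute[of w] mult.commute)
  finally show ?thesis by (auto simp: euclidean_representation)
qed

text \<open>The solution is a component of the inverse of the map \<open>(u, v) \<mapsto> (u, gram (h u) v)\<close>,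
  to which the inverse function theorem applies.\<close>

lemma nondegenerate_solution_differentiable:
  fixes h :: "'e::euclidean_space \<Rightarrow> 'e \<Rightarrow> 'e \<Rightarrow> real"
  assumes "open U" "u0 \<in> U"
    and bil: "\<And>u. u \<in> U \<Longrightarrow> bilinear (h u)"
    and nd: "\<And>u v. u \<in> U \<Longrightarrow> (\<And>w. h u v w = 0) \<Longrightarrow> v = 0"
    and dh: "\<And>u x y. u \<in> U \<Longrightarrow> (\<lambda>u. h u x y) differentiable (at u)"
    and da: "\<And>z. (\<lambda>u. \<alpha> u z) differentiable (at u0)"
    and s: "\<And>u z. u \<in> U \<Longrightarrow> h u (s u) z = \<alpha> u z"
  shows "s differentiable (at u0)"
proof -
  define F where "F p = (fst p, gram (h (fst p)) (snd p))" for p :: "'e \<times> 'e"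
  define g where "g p = (fst p, inv (gram (h (fst p))) (snd p))" for p :: "'e \<times> 'e"
  define L where "L u v du = (\<Sum>b\<in>Basis. (\<Sum>b'\<in>Basis. (v \<bullet> b') * frechet_derivative (\<lambda>u. h u b' b) (at u) du) *\<^sub>R b)" for u v du
  have inv: "inv (gram (h u)) (gram (h u) v) = v" if "u \<in> U" for u v
    using inj_gram[OF bil nd] that by (simp add: inv_f_f)
  have expand: "gram (h u) v = (\<Sum>b\<in>Basis. (\<Sum>b'\<in>Basis. (v \<bullet> b') * h u b' b) *\<^sub>R b)" if "u \<in> U" for u v
  proof -
    have "h u v b = (\<Sum>b'\<in>Basis. (v \<bullet> b') * h u b' b)" for b
    proof -
      have l: "linear (\<lambda>v. h u v b)" using bil[OF that] by (simp add: bilinear_def)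
      have "h u v b = h u (\<Sum>b'\<in>Basis. (v \<bullet> b') *\<^sub>R b') b" by (simp add: euclidean_representation)
      also have "\<dots> = (\<Sum>b'\<in>Basis. (v \<bullet> b') * h u b' b)"
        by (simp add: linear_sum[OF l] linear_cmul[OF l])
      finally show ?thesis .
    qed
    then show ?thesis by (simp add: gram_def)
  qed
  have D: "(F has_derivative (\<lambda>d. (fst d, L u v (fst d) + gram (h u) (snd d)))) (at (u, v))" if "u \<in> U" for u v
  proof -
    have 1: "((\<lambda>p. h (fst p) b' b) has_derivative (\<lambda>d. frechet_derivative (\<lambda>u. h u b' b) (at u) (fst d))) (at (u, v))" for b b'
      using has_derivative_compose[OF has_derivative_fst[OF has_derivative_ident], of "\<lambda>u. h u b' b" _ "(u,v)" UNIV]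
        has_frechet_derivative[OF dh[OF that]] by simp
    have "((\<lambda>p. (fst p, \<Sum>b\<in>Basis. (\<Sum>b'\<in>Basis. (snd p \<bullet> b') * h (fst p) b' b) *\<^sub>R b)) has_derivative
        (\<lambda>d. (fst d, \<Sum>b\<in>Basis. (\<Sum>b'\<in>Basis. (v \<bullet> b') * frechet_derivative (\<lambda>u. h u b' b) (at u) (fst d) + (snd d \<bullet> b') * h u b' b) *\<^sub>R b))) (at (u, v))"
      by (auto intro!: derivative_eq_intros 1)
    then have "((\<lambda>p. (fst p, \<Sum>b\<in>Basis. (\<Sum>b'\<in>Basis. (snd p \<bullet> b') * h (fst p) b' b) *\<^sub>R b)) has_derivative
        (\<lambda>d. (fst d, L u v (fst d) + gram (h u) (snd d)))) (at (u, v))"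
      by (simp add: L_def expand[OF that] sum.distrib scaleR_add_left)
    then show ?thesis
      by (rule has_derivative_transform_within_open[of _ _ _ _ "U \<times> UNIV"])
         (use assms(1) that in \<open>auto simp: F_def expand open_Times\<close>)
  qed
  obtain B where B: "linear B" "\<And>x. gram (h u0) (B x) = x"
    using linear_injective_isomorphism[OF linear_gram[OF bil[OF assms(2)]] inj_gram[OF bil[OF assms(2)] nd[OF assms(2)]]] by metis
  have "(g has_derivative (\<lambda>d. (fst d, B (snd d - L u0 (s u0) (fst d))))) (at (F (u0, s u0)))"
  \<comment> \<open>The derivative of \<open>F\<close> at (u0, s u0) is block triangular with the
    invertible block \<open>gram (h u0)\<close>, so its inverse is explicit. Since \<open>g\<close>
    is already a left inverse of \<open>F\<close> on U x UNIV, differentiability of \<open>F\<close>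
    at this point and continuity suffice.\<close>
  proof (rule has_derivative_inverse_strong[where S = "U \<times> UNIV" and f = F
        and f' = "\<lambda>d. (fst d, L u0 (s u0) (fst d) + gram (h u0) (snd d))"])
    show "continuous_on (U \<times> UNIV) F"
      using D by (auto intro!: continuous_at_imp_continuous_on has_derivative_continuous)
    show "(F has_derivative (\<lambda>d. (fst d, L u0 (s u0) (fst d) + gram (h u0) (snd d)))) (at (u0, s u0))"
      by (rule D[OF assms(2)])
  qed (use assms(1,2) B(2) in \<open>auto simp: open_Times F_def g_def inv fun_eq_iff\<close>)
  moreover have a: "gram (h u) (s u) = (\<Sum>b\<in>Basis. \<alpha> u b *\<^sub>R b)" if "u \<in> U" for u
    using s[OF that] by (simp add: gram_def)
  ultimately have g: "g differentiable (at (u0, \<Sum>b\<in>Basis. \<alpha> u0 b *\<^sub>R b))"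
    using assms(2) by (auto simp: F_def differentiable_def)
  \<comment> \<open>\<open>s\<close> is the second component of \<open>g\<close> along the curve of
    right-hand sides, by \<open>a\<close> and \<open>inv\<close>.\<close>
  have "(\<lambda>u. (u, \<Sum>b\<in>Basis. \<alpha> u b *\<^sub>R b)) differentiable (at u0)"
    by (rule differentiableI, rule has_derivative_Pair[OF has_derivative_ident],
        rule has_derivative_sum, rule has_derivative_scaleR_left, rule has_frechet_derivative[OF da])
  with g have "(\<lambda>u. g (u, \<Sum>b\<in>Basis. \<alpha> u b *\<^sub>R b)) differentiable (at u0)"
    by (rule differentiable_compose)
  then have "(\<lambda>u. snd (g (u, \<Sum>b\<in>Basis. \<alpha> u b *\<^sub>R b))) differentiable (at u0)"
    by (auto simp: differentiable_def intro: has_derivative_snd)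
  then obtain D' where "((\<lambda>u. snd (g (u, \<Sum>b\<in>Basis. \<alpha> u b *\<^sub>R b))) has_derivative D') (at u0)"
    by (auto simp: differentiable_def)
  then have "(s has_derivative D') (at u0)"
    by (rule has_derivative_transform_within_open[OF _ assms(1,2)]) (simp add: g_def a[symmetric] inv)
  then show ?thesis by (auto simp: differentiable_def)
qed

section \<open>The Levi-Civita connection in a chart\<close>

lemma christoffel_eqI:
  fixes h :: "'e::euclidean_space \<Rightarrow> 'e \<Rightarrow> 'e \<Rightarrow> real"
  assumes bil: "bilinear (h u)" and sym: "\<And>x y. h u x y = h u y x"
    and nd: "\<And>v. (\<And>w. h u v w = 0) \<Longrightarrow> v = 0"
    and G: "\<And>x y. G x y = G y x"
      "\<And>x y z. frechet_derivative (\<lambda>u. h u y z) (at u) x = h u (G x y) z + h u y (G x z)"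
  shows "christoffel h u = G"
  unfolding christoffel_def
proof (rule the_equality)
  fix G' assume "(\<forall>x y. G' x y = G' y x) \<and>
    (\<forall>x y z. frechet_derivative (\<lambda>u. h u y z) (at u) x = h u (G' x y) z + h u y (G' x z))"
  then have G': "\<And>x y. G' x y = G' y x"
    "\<And>x y z. frechet_derivative (\<lambda>u. h u y z) (at u) x = h u (G' x y) z + h u y (G' x z)" by auto
  \<comment> \<open>The difference of two candidates is symmetric in its first two arguments (no
    torsion) and skew in the last two (metric). Alternating the two swaps three times each returns
    to the start with the opposite sign, so it vanishes.\<close>
  define a where "a x y z = h u (G' x y - G x y) z" for x y z
  have a_sub: "a x y z = h u (G' x y) z - h u (G x y) z" for x y z
    by (simp add: a_def bilinear_lsub[OF bil])
  have 1: "a x y z = a y x z" for x y z using G(1) G'(1) by (simp add: a_def)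
  have 2: "a x y z = - a x z y" for x y z
    using G(2)[where x=x and y=y and z=z] G'(2)[where x=x and y=y and z=z] by (simp add: a_sub sym)
  have "a x y z = - a x y z" for x y z
    by (metis 1 2 minus_minus)
  then have "a x y z = 0" for x y z by (simp add: equal_neg_zero)
  then have "G' x y - G x y = 0" for x y by (intro nd) (simp add: a_def)
  then show "G' = G" by (auto simp: fun_eq_iff)
qed (use G in auto)

text \<open>Order 2 is what the curvature calls for: \<open>\<Gamma>\<close> contains first
  derivatives of h and is differentiated once.\<close>

locale local_metric =
  fixes U :: "'e::euclidean_space set" and h :: "'e \<Rightarrow> 'e \<Rightarrow> 'e \<Rightarrow> real"
  assumes open_U: "open U"
    and bil: "u \<in> U \<Longrightarrow> bilinear (h u)"
    and sym: "u \<in> U \<Longrightarrow> h u x y = h u y x"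
    and nondeg: "u \<in> U \<Longrightarrow> (\<And>w. h u v w = 0) \<Longrightarrow> v = 0"
    and C2: "Ck_on 2 U (\<lambda>u. h u x y)"
begin

abbreviation "Dh u x y z \<equiv> frechet_derivative (\<lambda>u. h u y z) (at u) x"
abbreviation "\<Gamma> \<equiv> christoffel h"

lemma C2': "Ck_on (Suc (Suc 0)) U (\<lambda>u. h u x y)"
  using C2 by (simp add: numeral_2_eq_2)

lemma C1': "Ck_on (Suc 0) U (\<lambda>u. Dh u x y z)"
  using C2' Ck_on.simps(2) by blast

lemmas metric_simps =
  bilinear_ladd[OF bil] bilinear_radd[OF bil] bilinear_lmul[OF bil] bilinear_rmul[OF bil]
  bilinear_lsub[OF bil] bilinear_rsub[OF bil] bilinear_lneg[OF bil] bilinear_rneg[OF bil] bilinear_lzero[OF bil] bilinear_rzero[OF bil]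

lemma has_derivative_metric: "u \<in> U \<Longrightarrow> ((\<lambda>u. h u y z) has_derivative (\<lambda>x. Dh u x y z)) (at u)"
  using Ck_on_SucD[OF C2'] .

lemma differentiable_metric_derivative: "u \<in> U \<Longrightarrow> (\<lambda>u. Dh u x y z) differentiable (at u)"
  using C1' by auto

lemma linear_Dh: "u \<in> U \<Longrightarrow> linear (\<lambda>x. Dh u x y z)"
  by (rule has_derivative_linear[OF has_derivative_metric])

lemma Dh_sym: "u \<in> U \<Longrightarrow> Dh u x y z = Dh u x z y"
  by (rule fun_cong[OF frechet_derivative_cong_open[OF open_U _ sym]])

lemma linear_Dh_middle:
  assumes u: "u \<in> U" shows "linear (\<lambda>y. Dh u x y z)"
proof (rule linearI)
  fix y y' and r :: real
  have "((\<lambda>u. h u y z + h u y' z) has_derivative (\<lambda>x. Dh u x y z + Dh u x y' z)) (at u)"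
    by (intro has_derivative_add has_derivative_metric u)
  then have "((\<lambda>u. h u (y + y') z) has_derivative (\<lambda>x. Dh u x y z + Dh u x y' z)) (at u)"
    by (rule has_derivative_transform_within_open[OF _ open_U u]) (simp add: metric_simps)
  then show "Dh u x (y + y') z = Dh u x y z + Dh u x y' z" by (simp add: frechet_derivative_eqI)
  have "((\<lambda>u. r *\<^sub>R h u y z) has_derivative (\<lambda>x. r *\<^sub>R Dh u x y z)) (at u)"
    by (intro has_derivative_scaleR_right has_derivative_metric u)
  then have "((\<lambda>u. h u (r *\<^sub>R y) z) has_derivative (\<lambda>x. r *\<^sub>R Dh u x y z)) (at u)"
    by (rule has_derivative_transform_within_open[OF _ open_U u]) (simp add: metric_simps)
  then show "Dh u x (r *\<^sub>R y) z = r *\<^sub>R Dh u x y z" by (simp add: frechet_derivative_eqI)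
qed

lemma linear_Dh_right: "u \<in> U \<Longrightarrow> linear (\<lambda>z. Dh u x y z)"
  using linear_Dh_middle[where u=u and z=y and x=x] Dh_sym[where u=u and x=x and y=y] by simp

lemma metric_eqI: "u \<in> U \<Longrightarrow> (\<And>w. h u v w = h u v' w) \<Longrightarrow> v = v'"
  using nondeg[of u "v - v'"] by (simp add: metric_simps)

text \<open>The Koszul formula for constant fields, whose brackets vanish. Its right-hand side is
  linear in z, so nondegeneracy yields the representing vector.\<close>

lemma koszul_represent:
  assumes u: "u \<in> U"
  obtains G where "\<And>x y z. h u (G x y) z = (Dh u x y z + Dh u y x z - Dh u z x y) / 2"
proof -
  have "linear (\<lambda>z. (Dh u x y z + Dh u y x z - Dh u z x y) / 2)" for x y
    using linear_Dh_right[OF u] linear_Dh[OF u]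
    unfolding linear_iff by (simp add: algebra_simps add_divide_distrib diff_divide_distrib)
  then have "\<forall>x y. \<exists>v. \<forall>z. h u v z = (Dh u x y z + Dh u y x z - Dh u z x y) / 2"
    using nondegenerate_represent[OF bil[OF u] nondeg[OF u]] by blast
  then obtain G where "\<forall>x y z. h u (G x y) z = (Dh u x y z + Dh u y x z - Dh u z x y) / 2"
    by metis
  then show ?thesis using that by blast
qed

text \<open>The Koszul solution satisfies the two conditions in the description of
  \<open>christoffel\<close>, and \<open>christoffel_eqI\<close> says that nothing else
  does.\<close>

lemma
  assumes u: "u \<in> U"
  shows koszul: "h u (\<Gamma> u x y) z = (Dh u x y z + Dh u y x z - Dh u z x y) / 2"
    and christoffel_sym: "\<Gamma> u x y = \<Gamma> u y x"
    and christoffel_compat: "Dh u x y z = h u (\<Gamma> u x y) z + h u y (\<Gamma> u x z)"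
proof -
  obtain G where G: "\<And>x y z. h u (G x y) z = (Dh u x y z + Dh u y x z - Dh u z x y) / 2"
    using koszul_represent[OF u] by blast
  have Gsym: "G x y = G y x" for x y
    by (rule metric_eqI[OF u]) (simp add: G Dh_sym[OF u, of x y])
  have Gcompat: "Dh u x y z = h u (G x y) z + h u y (G x z)" for x y z
    unfolding sym[OF u, of y "G x z"] by (simp add: G Dh_sym[OF u, of z y x] field_simps)
  have "\<Gamma> u = G" by (rule christoffel_eqI[OF bil[OF u] sym[OF u] nondeg[OF u] Gsym Gcompat])
  then show "h u (\<Gamma> u x y) z = (Dh u x y z + Dh u y x z - Dh u z x y) / 2" "\<Gamma> u x y = \<Gamma> u y x"
    "Dh u x y z = h u (\<Gamma> u x y) z + h u y (\<Gamma> u x z)"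
    using G Gsym Gcompat by auto
qed

text \<open>\<open>christoffel\<close> is a description over arbitrary binary functions, so
  linearity is recovered from the Koszul formula, tested against every w.\<close>

lemma linear_christoffel: "u \<in> U \<Longrightarrow> linear (\<Gamma> u x)"
proof (rule linearI)
  fix y y' and r :: real assume u: "u \<in> U"
  note l = linear_Dh[OF u] linear_Dh_middle[OF u] linear_Dh_right[OF u]
  show "\<Gamma> u x (y + y') = \<Gamma> u x y + \<Gamma> u x y'"
    by (rule metric_eqI[OF u])
       (simp add: metric_simps u koszul l[THEN linear_add] add_divide_distrib diff_divide_distrib)
  show "\<Gamma> u x (r *\<^sub>R y) = r *\<^sub>R \<Gamma> u x y"
    by (rule metric_eqI[OF u])
       (simp add: metric_simps u koszul l[THEN linear_cmul] algebra_simps add_divide_distrib diff_divide_distrib)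
qed

lemma bilinear_christoffel: "u \<in> U \<Longrightarrow> bilinear (\<Gamma> u)"
  using linear_christoffel[of u] christoffel_sym[of u] unfolding bilinear_def by auto

lemmas christoffel_simps =
  bilinear_ladd[OF bilinear_christoffel] bilinear_radd[OF bilinear_christoffel]
  bilinear_lmul[OF bilinear_christoffel] bilinear_rmul[OF bilinear_christoffel]
  bilinear_lzero[OF bilinear_christoffel] bilinear_rzero[OF bilinear_christoffel]

lemma solution_differentiable:
  assumes "u \<in> U" "\<And>z. (\<lambda>u. \<alpha> u z) differentiable (at u)" "\<And>u z. u \<in> U \<Longrightarrow> h u (s u) z = \<alpha> u z"
  shows "s differentiable (at u)"
  using has_derivative_metric
  by (intro nondegenerate_solution_differentiable[OF open_U assms(1) bil nondeg _ assms(2,3)])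
     (auto simp: differentiable_def)

lemma christoffel_differentiable:
  assumes "u \<in> U" shows "(\<lambda>u. \<Gamma> u x y) differentiable (at u)"
proof (rule solution_differentiable[OF assms _ koszul])
  fix z
  show "(\<lambda>u. (Dh u x y z + Dh u y x z - Dh u z x y) / 2) differentiable (at u)"
    unfolding divide_inverse
    by (intro differentiable_mult differentiable_diff differentiable_add differentiable_metric_derivative assms) simp
qed

lemmas has_derivative_christoffel = has_frechet_derivative[OF christoffel_differentiable]

lemma has_derivative_metric_field:
  assumes u: "u \<in> U" and V: "(V has_derivative V') (at u)"
  shows "((\<lambda>u. h u (V u) y) has_derivative (\<lambda>x. h u (V' x) y + Dh u x (V u) y)) (at u)"
proof -
  \<comment> \<open>Derivatives of h are known for constant arguments only; expanding in the basis
    moves the varying vector \<open>V u\<close> into scalar coefficients.\<close>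
  have expand: "l v = (\<Sum>b\<in>Basis. (v \<bullet> b) * l b)" if "linear l" for l :: "'e \<Rightarrow> real" and v
  proof -
    have "l v = l (\<Sum>b\<in>Basis. (v \<bullet> b) *\<^sub>R b)" by (simp add: euclidean_representation)
    then show ?thesis by (simp add: linear_sum[OF that] linear_cmul[OF that])
  qed
  have e1: "h w v y = (\<Sum>b\<in>Basis. (v \<bullet> b) * h w b y)" if "w \<in> U" for w v
    using bil[OF that] by (intro expand) (simp add: bilinear_def)
  have e2: "Dh u x v y = (\<Sum>b\<in>Basis. (v \<bullet> b) * Dh u x b y)" for x v
    by (rule expand[OF linear_Dh_middle[OF u]])
  have "((\<lambda>u. \<Sum>b\<in>Basis. (V u \<bullet> b) * h u b y) has_derivative
      (\<lambda>x. \<Sum>b\<in>Basis. (V u \<bullet> b) * Dh u x b y + (V' x \<bullet> b) * h u b y)) (at u)"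
    by (intro has_derivative_sum has_derivative_mult has_derivative_inner_left V has_derivative_metric u)
  then have "((\<lambda>u. h u (V u) y) has_derivative
      (\<lambda>x. \<Sum>b\<in>Basis. (V u \<bullet> b) * Dh u x b y + (V' x \<bullet> b) * h u b y)) (at u)"
    by (rule has_derivative_transform_within_open[OF _ open_U u]) (simp add: e1)
  moreover have "(\<Sum>b\<in>Basis. (V u \<bullet> b) * Dh u x b y + (V' x \<bullet> b) * h u b y) = h u (V' x) y + Dh u x (V u) y" for x
    by (simp add: e1[OF u, of "V' x"] e2[where x=x and v="V u"] sum.distrib)
  ultimately show ?thesis by simp
qed

text \<open>The Lie derivative is twice the symmetrised covariant derivative: the bracket of X with
  a constant y is minus the derivative of X along y, and compatibility with symmetry of
  \<open>\<Gamma>\<close> rewrites the derivative of h along X. This form is linear in the field and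
  brings in the Hessian when the field is a gradient.\<close>

lemma lie_metric_eq:
  assumes u: "u \<in> U"
  shows "lie_metric h X u y z =
    h u (frechet_derivative X (at u) y + \<Gamma> u y (X u)) z + h u y (frechet_derivative X (at u) z + \<Gamma> u z (X u))"
  using u
  by (simp add: lie_metric_def bracket_def metric_simps christoffel_compat[OF u] christoffel_sym[OF u, of _ "X u"])

end

text \<open>Constant fields commute, so the bracket term is reduced to \<open>\<Gamma>\<close> at
  the zero vector. It disappears only where \<open>\<Gamma>\<close> is known to be bilinear.\<close>

lemma curvature_const:
  "curvature h (\<lambda>_. x) (\<lambda>_. y) (\<lambda>_. z) u =
     frechet_derivative (\<lambda>u. christoffel h u y z) (at u) x + christoffel h u x (christoffel h u y z)
   - (frechet_derivative (\<lambda>u. christoffel h u x z) (at u) y + christoffel h u y (christoffel h u x z))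
   - christoffel h u 0 z"
proof -
  have c: "cov h (\<lambda>_. a) (\<lambda>_. b) = (\<lambda>u. christoffel h u a b)" for a b
    by (simp add: cov_def fun_eq_iff)
  have "bracket (\<lambda>_. x) (\<lambda>_. y) u = 0" by (simp add: bracket_def)
  then show ?thesis by (simp add: curvature_def c) (simp add: cov_def)
qed

text \<open>The gradient enters through its defining equation alone; its differentiability is
  derived in \<open>has_derivative_gradient\<close>, as for the Christoffel symbols.\<close>

locale local_gradient = local_metric U h
  for U :: "'e::euclidean_space set" and h +
  fixes \<phi> :: "'e \<Rightarrow> real" and G :: "'e \<Rightarrow> 'e"
  assumes phi_C2: "Ck_on 2 U \<phi>"
    and G: "u \<in> U \<Longrightarrow> h u (G u) z = frechet_derivative \<phi> (at u) z"
begin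

abbreviation "d\<phi> u \<equiv> frechet_derivative \<phi> (at u)"
abbreviation "DG u x \<equiv> frechet_derivative G (at u) x + \<Gamma> u x (G u)"

lemma phi_C2': "Ck_on (Suc (Suc 0)) U \<phi>"
  using phi_C2 by (simp add: numeral_2_eq_2)

lemma has_derivative_phi: "u \<in> U \<Longrightarrow> (\<phi> has_derivative d\<phi> u) (at u)"
  using Ck_on_SucD[OF phi_C2'] .

lemma has_derivative_dphi:
  "u \<in> U \<Longrightarrow> ((\<lambda>u. d\<phi> u z) has_derivative frechet_derivative (\<lambda>u. d\<phi> u z) (at u)) (at u)"
  using phi_C2' by (intro has_frechet_derivative) auto

lemma linear_dphi: "u \<in> U \<Longrightarrow> linear (d\<phi> u)"
  by (rule has_derivative_linear[OF has_derivative_phi])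

lemma has_derivative_gradient: "u \<in> U \<Longrightarrow> (G has_derivative frechet_derivative G (at u)) (at u)"
  using has_derivative_dphi
  by (intro has_frechet_derivative solution_differentiable[OF _ _ G]) (auto simp: differentiable_def)

text \<open>Differentiate h(G, y) = \<open>d\<phi>\<close> y along x: compatibility splits the
  derivative of h into the missing part of \<open>DG\<close> and h(G, \<open>\<Gamma>\<close> x y),
  which is again a value of \<open>d\<phi>\<close>.\<close>

lemma hessian_eq:
  assumes u: "u \<in> U"
  shows "h u (DG u x) y = frechet_derivative (\<lambda>u. d\<phi> u y) (at u) x - d\<phi> u (\<Gamma> u x y)"
proof -
  have "((\<lambda>u. d\<phi> u y) has_derivative (\<lambda>x. h u (frechet_derivative G (at u) x) y + Dh u x (G u) y)) (at u)"
    using has_derivative_metric_field[OF u has_derivative_gradient[OF u]]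
    by (rule has_derivative_transform_within_open[OF _ open_U u]) (simp add: G)
  then show ?thesis
    using G[OF u, of "\<Gamma> u x y"] u
    by (simp add: frechet_derivative_eqI christoffel_compat metric_simps)
qed

lemma hessian_sym: "u \<in> U \<Longrightarrow> h u (DG u x) y = h u (DG u y) x"
  by (simp add: hessian_eq christoffel_sym[of u x y] second_derivative_symmetric[OF open_U _ phi_C2, of u x y])

end

section \<open>Warped products of metrics in charts\<close>

lemma lin_trace_prod:
  fixes L :: "'e::euclidean_space \<times> 'f::euclidean_space \<Rightarrow> 'e \<times> 'f"
  shows "lin_trace L = (\<Sum>b\<in>Basis. fst (L (b, 0)) \<bullet> b) + (\<Sum>b\<in>Basis. snd (L (0, b)) \<bullet> b)"
proof -
  have "lin_trace L = (\<Sum>b\<in>(\<lambda>u. (u, 0)) ` Basis. L b \<bullet> b) + (\<Sum>b\<in>(\<lambda>v. (0, v)) ` Basis. L b \<bullet> b)"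
    unfolding lin_trace_def Basis_prod_def by (rule sum.union_disjoint) (auto simp: nonzero_Basis)
  then show ?thesis by (simp add: sum.reindex inj_on_def inner_prod_def)
qed

lemma ricci_eq:
  "ricci h u y z = (\<Sum>b\<in>Basis. curvature h (\<lambda>_. b) (\<lambda>_. y) (\<lambda>_. z) u \<bullet> b)"
  by (simp add: ricci_def lin_trace_def)

lemma has_derivative_fst_comp:
  "(f has_derivative f') (at u) \<Longrightarrow> ((\<lambda>w. f (fst w)) has_derivative (\<lambda>X. f' (fst X))) (at (u, v))"
  using has_derivative_compose[OF has_derivative_fst[OF has_derivative_ident], of f f' "(u, v)" UNIV] by simp

lemma has_derivative_snd_comp:
  "(f has_derivative f') (at v) \<Longrightarrow> ((\<lambda>w. f (snd w)) has_derivative (\<lambda>X. f' (snd X))) (at (u, v))"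
  using has_derivative_compose[OF has_derivative_snd[OF has_derivative_ident], of f f' "(u, v)" UNIV] by simp

text \<open>\<open>H\<close> stands for the chart expression of the warped metric. Its formula is
  demanded over U1 x U2 only, since chart expressions are uncontrolled outside the chart range;
  \<open>has_derivative_local\<close> transfers derivatives accordingly.\<close>

locale local_warped = B: local_gradient U1 h1 \<phi> G + F: local_metric U2 h2
  for U1 :: "'e::euclidean_space set" and h1 \<phi> G and U2 :: "'f::euclidean_space set" and h2 +
  fixes H :: "'e \<times> 'f \<Rightarrow> 'e \<times> 'f \<Rightarrow> 'e \<times> 'f \<Rightarrow> real"
  assumes pos: "u \<in> U1 \<Longrightarrow> \<phi> u > 0"
    and H: "u \<in> U1 \<Longrightarrow> v \<in> U2 \<Longrightarrow>
      H (u, v) X Y = h1 u (fst X) (fst Y) + (\<phi> u)\<^sup>2 * h2 v (snd X) (snd Y)"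
begin

abbreviation "d\<phi> \<equiv> B.d\<phi>"

lemma has_derivative_local:
  assumes "u \<in> U1" "v \<in> U2" "(f has_derivative f') (at (u, v))"
    and "\<And>u v. u \<in> U1 \<Longrightarrow> v \<in> U2 \<Longrightarrow> f (u, v) = g (u, v)"
  shows "(g has_derivative f') (at (u, v))"
  by (rule has_derivative_transform_within_open[OF assms(3), of "U1 \<times> U2"])
     (use assms B.open_U F.open_U in \<open>auto simp: open_Times\<close>)

lemma has_derivative_H:
  assumes u: "u \<in> U1" and v: "v \<in> U2"
  shows "((\<lambda>w. H w Y Z) has_derivative (\<lambda>X. B.Dh u (fst X) (fst Y) (fst Z) +
     (2 * \<phi> u * d\<phi> u (fst X) * h2 v (snd Y) (snd Z) + (\<phi> u)\<^sup>2 * F.Dh v (snd X) (snd Y) (snd Z)))) (at (u, v))"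
proof (rule has_derivative_local[OF u v])
  show "((\<lambda>w. h1 (fst w) (fst Y) (fst Z) + (\<phi> (fst w))\<^sup>2 * h2 (snd w) (snd Y) (snd Z)) has_derivative
    (\<lambda>X. B.Dh u (fst X) (fst Y) (fst Z) +
     (2 * \<phi> u * d\<phi> u (fst X) * h2 v (snd Y) (snd Z) + (\<phi> u)\<^sup>2 * F.Dh v (snd X) (snd Y) (snd Z)))) (at (u, v))"
    unfolding power2_eq_square
    by (rule has_derivative_eq_rhs[OF has_derivative_add[OF has_derivative_fst_comp[OF B.has_derivative_metric[OF u]]
        has_derivative_mult[OF has_derivative_mult[OF has_derivative_fst_comp[OF B.has_derivative_phi[OF u]]
          has_derivative_fst_comp[OF B.has_derivative_phi[OF u]]]
         has_derivative_snd_comp[OF F.has_derivative_metric[OF v]]]]])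
       (simp add: algebra_simps)
qed (simp add: H)

lemma bilinear_H:
  assumes u: "u \<in> U1" and v: "v \<in> U2"
  shows "bilinear (H (u, v))"
  unfolding bilinear_def linear_iff
  by (simp add: H u v B.metric_simps F.metric_simps algebra_simps)

lemma nondeg_H:
  assumes u: "u \<in> U1" and v: "v \<in> U2" and 0: "\<And>Y. H (u, v) X Y = 0"
  shows "X = 0"
proof -
  have "fst X = 0" using 0[of "(_, 0)"] by (intro B.nondeg[OF u]) (simp add: H u v F.metric_simps)
  moreover have "snd X = 0"
    using 0[of "(0, _)"] pos[OF u] by (intro F.nondeg[OF v]) (simp add: H u v B.metric_simps)
  ultimately show ?thesis by (simp add: prod_eq_iff)
qed

lemma christoffel_warped:
  assumes u: "u \<in> U1" and v: "v \<in> U2"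
  shows "christoffel H (u, v) X Y =
    (B.\<Gamma> u (fst X) (fst Y) - (\<phi> u * h2 v (snd X) (snd Y)) *\<^sub>R G u,
     F.\<Gamma> v (snd X) (snd Y) + (d\<phi> u (fst X) / \<phi> u) *\<^sub>R snd Y + (d\<phi> u (fst Y) / \<phi> u) *\<^sub>R snd X)"
proof -
  have "christoffel H (u, v) = (\<lambda>X Y.
    (B.\<Gamma> u (fst X) (fst Y) - (\<phi> u * h2 v (snd X) (snd Y)) *\<^sub>R G u,
     F.\<Gamma> v (snd X) (snd Y) + (d\<phi> u (fst X) / \<phi> u) *\<^sub>R snd Y + (d\<phi> u (fst Y) / \<phi> u) *\<^sub>R snd X))"
    (is "_ = ?K")
  proof (rule christoffel_eqI)
    show "H (u, v) X Y = H (u, v) Y X" for X Y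
      by (simp add: H u v B.sym[OF u, of "fst X"] F.sym[OF v, of "snd X"])
    show "?K X Y = ?K Y X" for X Y
      by (simp add: B.christoffel_sym[OF u, of "fst X"] F.christoffel_sym[OF v, of "snd X"] F.sym[OF v, of "snd X"])
    \<comment> \<open>Pairing the G-term with Y and Z gives terms -\<open>\<phi>\<close> h2
      \<open>d\<phi>\<close>, cancelled by those in which \<open>d\<phi>\<close> is applied to Y or
      Z in the fibre component. The two terms with \<open>d\<phi>\<close> applied to X remain and
      add up to the derivative of the squared warping function.\<close>
    show "frechet_derivative (\<lambda>w. H w Y Z) (at (u, v)) X = H (u, v) (?K X Y) Z + H (u, v) Y (?K X Z)" for X Y Z
    proof -
      have 1: "h1 u (fst Y) (G u) = d\<phi> u (fst Y)" "h1 u (G u) (fst Z) = d\<phi> u (fst Z)"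
        by (simp_all add: B.G u B.sym[OF u, of "fst Y"])
      have 2: "h2 v (snd Y) (snd X) = h2 v (snd X) (snd Y)" using F.sym[OF v] .
      show ?thesis
        using pos[OF u]
        by (simp add: frechet_derivative_eqI[OF has_derivative_H[OF u v]] H u v B.metric_simps F.metric_simps
            B.christoffel_compat F.christoffel_compat 1 2 field_simps power2_eq_square)
    qed
  qed (use bilinear_H[OF u v] nondeg_H[OF u v] in auto)
  then show ?thesis by simp
qed

lemma has_derivative_christoffel_warped:
  assumes "u \<in> U1" "v \<in> U2" "(f has_derivative f') (at (u, v))"
    and "\<And>u v. u \<in> U1 \<Longrightarrow> v \<in> U2 \<Longrightarrow> f (u, v) = christoffel H (u, v) Y Z"
  shows "frechet_derivative (\<lambda>w. christoffel H w Y Z) (at (u, v)) = f'"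
  using has_derivative_local[OF assms] by (rule frechet_derivative_eqI)

lemmas warped_simps = christoffel_warped B.metric_simps F.metric_simps B.christoffel_simps F.christoffel_simps
  linear_0[OF B.linear_dphi] linear_cmul[OF B.linear_dphi]

text \<open>The trace splits over the factors. Base directions reproduce the curvature of h1. Every
  fibre direction b is an eigenvector with the same eigenvalue, minus the Hessian over
  \<open>\<phi>\<close>, which is counted once per dimension of the fibre.\<close>

lemma ricci_warped_base:
  assumes u: "u \<in> U1" and v: "v \<in> U2"
  shows "ricci H (u, v) (y, 0) (z, 0) = ricci h1 u y z - real DIM('f) / \<phi> u * h1 u (B.DG u y) z"
proof -
  note D1 = B.has_derivative_christoffel[OF u]
  have D: "frechet_derivative (\<lambda>w. christoffel H w (a, 0) (b, 0)) (at (u, v)) =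
      (\<lambda>X. (frechet_derivative (\<lambda>u. B.\<Gamma> u a b) (at u) (fst X), 0))" for a b
    by (rule has_derivative_christoffel_warped[OF u v has_derivative_Pair[OF has_derivative_fst_comp[OF D1] has_derivative_const]])
       (simp add: warped_simps)
  have 1: "fst (curvature H (\<lambda>_. (x, 0)) (\<lambda>_. (y, 0)) (\<lambda>_. (z, 0)) (u, v)) = curvature h1 (\<lambda>_. x) (\<lambda>_. y) (\<lambda>_. z) u" for x
    unfolding curvature_const D by (simp add: warped_simps u v)
  have quot: "((\<lambda>u. d\<phi> u z / \<phi> u) has_derivative
     (\<lambda>x. (frechet_derivative (\<lambda>u. d\<phi> u z) (at u) x * \<phi> u - d\<phi> u z * d\<phi> u x) / (\<phi> u * \<phi> u))) (at u)"
    using has_derivative_divide'[OF B.has_derivative_dphi[OF u] B.has_derivative_phi[OF u]] pos[OF u] by auto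
  have D': "frechet_derivative (\<lambda>w. christoffel H w (0, b) (z, 0)) (at (u, v)) =
      (\<lambda>X. (0, ((frechet_derivative (\<lambda>u. d\<phi> u z) (at u) (fst X) * \<phi> u - d\<phi> u z * d\<phi> u (fst X)) / (\<phi> u * \<phi> u)) *\<^sub>R b))" for b
    by (rule has_derivative_christoffel_warped[OF u v has_derivative_Pair[OF has_derivative_const
          has_derivative_scaleR_left[OF has_derivative_fst_comp[OF quot]]]])
       (simp add: warped_simps)
  \<comment> \<open>The product \<open>d\<phi>\<close> y \<open>d\<phi>\<close> z over the square of
    \<open>\<phi>\<close> occurs twice, from the quotient rule and from iterating
    \<open>\<Gamma>\<close>, with opposite signs.\<close>
  have 2: "snd (curvature H (\<lambda>_. (0, b)) (\<lambda>_. (y, 0)) (\<lambda>_. (z, 0)) (u, v)) = (- h1 u (B.DG u y) z / \<phi> u) *\<^sub>R b" for b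
    unfolding curvature_const D D' B.hessian_eq[OF u] using pos[OF u]
    by (simp add: warped_simps u v scaleR_diff_left[symmetric] scaleR_add_left[symmetric])
       (intro disjI1, simp add: field_simps)
  show ?thesis
    by (simp add: ricci_def[of H] lin_trace_prod 1 2 ricci_eq[of h1] inner_same_Basis)
qed

lemma ricci_warped_fibre:
  assumes u: "u \<in> U1" and v: "v \<in> U2"
  shows "ricci H (u, v) (0, y) (0, z) = ricci h2 v y z
    - (\<phi> u * lin_trace (B.DG u) + (real DIM('f) - 1) * h1 u (G u) (G u)) * h2 v y z"
proof -
  have fG: "((\<lambda>u. \<phi> u *\<^sub>R G u) has_derivative
     (\<lambda>x. \<phi> u *\<^sub>R frechet_derivative G (at u) x + d\<phi> u x *\<^sub>R G u)) (at u)"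
    by (intro has_derivative_scaleR B.has_derivative_phi B.has_derivative_gradient u)
  have D: "frechet_derivative (\<lambda>w. christoffel H w (0, a) (0, b)) (at (u, v)) =
      (\<lambda>X. (- (h2 v a b *\<^sub>R (\<phi> u *\<^sub>R frechet_derivative G (at u) (fst X) + d\<phi> u (fst X) *\<^sub>R G u)
               + F.Dh v (snd X) a b *\<^sub>R \<phi> u *\<^sub>R G u),
            frechet_derivative (\<lambda>v. F.\<Gamma> v a b) (at v) (snd X)))" for a b
    by (rule has_derivative_christoffel_warped[OF u v has_derivative_eq_rhs[OF has_derivative_Pair[OF
          has_derivative_minus[OF has_derivative_scaleR[OF has_derivative_snd_comp[OF F.has_derivative_metric[OF v, of a b]]
              has_derivative_fst_comp[OF fG]]]
          has_derivative_snd_comp[OF F.has_derivative_christoffel[OF v, of a b]]]]])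
       (simp_all add: warped_simps)
  \<comment> \<open>The second curvature term differentiates the mixed symbol along the fibre. Its
    base component is zero throughout, so nothing is contributed there.\<close>
  have D': "fst (frechet_derivative (\<lambda>w. christoffel H w (a, 0) (0, b)) (at (u, v)) (0, y)) = 0" for a b
  proof -
    have quot: "((\<lambda>u. d\<phi> u a / \<phi> u) has_derivative
       (\<lambda>x. (frechet_derivative (\<lambda>u. d\<phi> u a) (at u) x * \<phi> u - d\<phi> u a * d\<phi> u x) / (\<phi> u * \<phi> u))) (at u)"
      using has_derivative_divide'[OF B.has_derivative_dphi[OF u] B.has_derivative_phi[OF u]] pos[OF u] by auto
    have "frechet_derivative (\<lambda>w. christoffel H w (a, 0) (0, b)) (at (u, v)) =
      (\<lambda>X. (0, ((frechet_derivative (\<lambda>u. d\<phi> u a) (at u) (fst X) * \<phi> u - d\<phi> u a * d\<phi> u (fst X)) / (\<phi> u * \<phi> u)) *\<^sub>R b))"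
      by (rule has_derivative_christoffel_warped[OF u v has_derivative_Pair[OF has_derivative_const
          has_derivative_scaleR_left[OF has_derivative_fst_comp[OF quot]]]])
         (simp add: warped_simps)
    then show ?thesis by simp
  qed
  have 1: "fst (curvature H (\<lambda>_. (x, 0)) (\<lambda>_. (0, y)) (\<lambda>_. (0, z)) (u, v)) = - (\<phi> u * h2 v y z) *\<^sub>R B.DG u x" for x
    unfolding curvature_const using pos[OF u]
    by (simp add: D D') (simp add: warped_simps bilinear_rneg[OF B.bilinear_christoffel] linear_0[OF F.linear_Dh] u v algebra_simps)
  have G: "d\<phi> u (G u) = h1 u (G u) (G u)" using B.G[OF u] by simp
  have 2: "snd (curvature H (\<lambda>_. (0, x)) (\<lambda>_. (0, y)) (\<lambda>_. (0, z)) (u, v)) =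
     curvature h2 (\<lambda>_. x) (\<lambda>_. y) (\<lambda>_. z) v - h1 u (G u) (G u) *\<^sub>R (h2 v y z *\<^sub>R x - h2 v x z *\<^sub>R y)" for x
    unfolding curvature_const D using pos[OF u]
    by (simp add: warped_simps u v linear_neg[OF B.linear_dphi] G algebra_simps)
  \<comment> \<open>Contraction of the term that subtracts a multiple of y; it accounts for the -1
    in the coefficient of h1(G, G).\<close>
  have tr: "(\<Sum>b\<in>Basis. h2 v b z * (y \<bullet> b)) = h2 v y z"
  proof -
    have l: "linear (\<lambda>y. h2 v y z)" using F.bil[OF v] by (simp add: bilinear_def)
    have "h2 v y z = h2 v (\<Sum>b\<in>Basis. (y \<bullet> b) *\<^sub>R b) z" by (simp add: euclidean_representation)
    then show ?thesis by (simp add: linear_sum[OF l] linear_cmul[OF l] mult.commute)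
  qed
  have 3: "(\<Sum>b\<in>Basis. fst (curvature H (\<lambda>_. (b, 0)) (\<lambda>_. (0, y)) (\<lambda>_. (0, z)) (u, v)) \<bullet> b) =
      - (\<phi> u * h2 v y z) * lin_trace (B.DG u)"
    unfolding 1 by (simp add: lin_trace_def sum_distrib_left)
  have 4: "(\<Sum>b\<in>Basis. snd (curvature H (\<lambda>_. (0, b)) (\<lambda>_. (0, y)) (\<lambda>_. (0, z)) (u, v)) \<bullet> b) =
      ricci h2 v y z - h1 u (G u) (G u) * (real DIM('f) * h2 v y z - h2 v y z)"
    unfolding 2 by (simp add: inner_diff_left sum_subtractf ricci_eq sum_distrib_left[symmetric] tr inner_same_Basis)
  show ?thesis
    unfolding ricci_def[of H] lin_trace_prod 3 4 by (simp add: algebra_simps)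
qed

text \<open>Each component of X depends on its own factor, so the derivative of X is block diagonal.
  The extra fibre term is the derivative of the squared warping function along X1.\<close>

lemma lie_warped:
  assumes u: "u \<in> U1" and v: "v \<in> U2"
    and X1: "X1 differentiable (at u)" and X2: "X2 differentiable (at v)"
    and X: "\<And>u v. u \<in> U1 \<Longrightarrow> v \<in> U2 \<Longrightarrow> X (u, v) = (X1 u, X2 v)"
  shows "lie_metric H X (u, v) (y, 0) (z, 0) = lie_metric h1 X1 u y z"
    and "lie_metric H X (u, v) (0, y') (0, z') =
      2 * \<phi> u * d\<phi> u (X1 u) * h2 v y' z' + (\<phi> u)\<^sup>2 * lie_metric h2 X2 v y' z'"
proof -
  have D: "frechet_derivative X (at (u, v)) = (\<lambda>Y. (frechet_derivative X1 (at u) (fst Y), frechet_derivative X2 (at v) (snd Y)))"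
    by (rule frechet_derivative_eqI, rule has_derivative_local[OF u v has_derivative_Pair[OF
          has_derivative_fst_comp[OF has_frechet_derivative[OF X1]] has_derivative_snd_comp[OF has_frechet_derivative[OF X2]]]])
       (simp add: X)
  have 0: "frechet_derivative X1 (at u) 0 = 0" "frechet_derivative X2 (at v) 0 = 0"
    using linear_0 linear_frechet_derivative X1 X2 by blast+
  show "lie_metric H X (u, v) (y, 0) (z, 0) = lie_metric h1 X1 u y z"
    by (simp add: lie_metric_def bracket_def D frechet_derivative_eqI[OF has_derivative_H[OF u v]] H u v X
        F.metric_simps B.metric_simps linear_0[OF F.linear_Dh_middle[OF v]] 0)
  show "lie_metric H X (u, v) (0, y') (0, z') =
      2 * \<phi> u * d\<phi> u (X1 u) * h2 v y' z' + (\<phi> u)\<^sup>2 * lie_metric h2 X2 v y' z'"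
    by (simp add: lie_metric_def bracket_def D frechet_derivative_eqI[OF has_derivative_H[OF u v]] H u v X
        F.metric_simps B.metric_simps linear_0[OF B.linear_Dh_middle[OF u]] 0 algebra_simps)
qed

end

section \<open>Charts, tangent vectors and gradients\<close>

locale smooth_mfd =
  fixes M :: "('a, 'e::euclidean_space) manifold"
  assumes smooth_manifold: "smooth_manifold M"
begin

lemma charts_atD: "c \<in> charts_at M p \<Longrightarrow> c \<in> atlas M" "c \<in> charts_at M p \<Longrightarrow> p \<in> chart_dom c"
  by (simp_all add: charts_at_def)

lemma
  assumes "c \<in> atlas M"
  shows openin_chart_dom: "openin (topo M) (chart_dom c)"
    and open_chart_range: "open (chart_range c)"
    and homeomorphic_chart_map:
      "homeomorphic_map (subtopology (topo M) (chart_dom c)) (top_of_set (chart_range c)) (chart_map c)"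
  using smooth_manifold assms by (auto simp: smooth_manifold_def)

lemma chart_dom_subset: "c \<in> atlas M \<Longrightarrow> chart_dom c \<subseteq> points M"
  using openin_chart_dom openin_subset by blast

lemma charts_at_points: "c \<in> charts_at M p \<Longrightarrow> p \<in> points M"
  using charts_atD chart_dom_subset by blast

lemma inj_on_chart_map: "c \<in> atlas M \<Longrightarrow> inj_on (chart_map c) (chart_dom c)"
  using homeomorphic_imp_injective_map[OF homeomorphic_chart_map, of c] chart_dom_subset[of c]
  by (simp add: Int_absorb1)

lemma chart_inv_map: "c \<in> atlas M \<Longrightarrow> p \<in> chart_dom c \<Longrightarrow> chart_inv c (chart_map c p) = p"
  by (simp add: chart_inv_def inj_on_chart_map)

lemma chart_map_inv: "u \<in> chart_range c \<Longrightarrow> chart_map c (chart_inv c u) = u"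
  by (simp add: chart_inv_def chart_range_def f_inv_into_f)

lemma chart_inv_dom: "u \<in> chart_range c \<Longrightarrow> chart_inv c u \<in> chart_dom c"
  by (simp add: chart_inv_def chart_range_def inv_into_into)

lemma chart_map_range: "p \<in> chart_dom c \<Longrightarrow> chart_map c p \<in> chart_range c"
  by (simp add: chart_range_def)

lemma chart_inv_charts_at: "c \<in> atlas M \<Longrightarrow> u \<in> chart_range c \<Longrightarrow> c \<in> charts_at M (chart_inv c u)"
  by (simp add: charts_at_def chart_inv_dom)

lemma some_chart: "p \<in> points M \<Longrightarrow> some_chart M p \<in> charts_at M p"
proof -
  assume "p \<in> points M"
  then have "\<exists>c. c \<in> charts_at M p" using smooth_manifold by (auto simp: smooth_manifold_def charts_at_def)
  then show ?thesis unfolding some_chart_def by (rule someI_ex)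
qed

lemma open_chart_image:
  assumes "c \<in> atlas M" "openin (topo M) W"
  shows "open (chart_map c ` (chart_dom c \<inter> W))"
proof -
  have "openin (subtopology (topo M) (chart_dom c)) (chart_dom c \<inter> W)"
    using assms(2) by (metis openin_subtopology_Int2)
  then have "openin (top_of_set (chart_range c)) (chart_map c ` (chart_dom c \<inter> W))"
    using homeomorphic_imp_open_map[OF homeomorphic_chart_map[OF assms(1)]] by (auto simp: open_map_def)
  then show ?thesis using open_chart_range[OF assms(1)] openin_open_trans by blast
qed

lemma transition_smooth:
  assumes "c \<in> atlas M" "d \<in> atlas M"
  shows "Ck_on k (chart_map c ` (chart_dom c \<inter> chart_dom d)) (chart_map d \<circ> chart_inv c)"
  using smooth_manifold assms by (auto simp: smooth_manifold_def smooth_on_def)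

lemma transition_has_derivative:
  assumes "c \<in> charts_at M p" "d \<in> charts_at M p"
  shows "((chart_map d \<circ> chart_inv c) has_derivative
           frechet_derivative (chart_map d \<circ> chart_inv c) (at (chart_map c p))) (at (chart_map c p))"
  using Ck_on_SucD[OF transition_smooth] assms by (auto simp: charts_at_def)

lemma transition_linear:
  assumes "c \<in> charts_at M p" "d \<in> charts_at M p"
  shows "linear (frechet_derivative (chart_map d \<circ> chart_inv c) (at (chart_map c p)))"
  using has_derivative_linear[OF transition_has_derivative[OF assms]] .

lemma transition_self:
  assumes "c \<in> charts_at M p"
  shows "frechet_derivative (chart_map c \<circ> chart_inv c) (at (chart_map c p)) x = x"
proof -
  have "frechet_derivative (chart_map c \<circ> chart_inv c) (at (chart_map c p)) = frechet_derivative (\<lambda>u. u) (at (chart_map c p))"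
    using assms by (intro frechet_derivative_cong_open[of "chart_range c"])
      (auto simp: charts_at_def open_chart_range chart_map_range chart_map_inv)
  then show ?thesis by simp
qed

text \<open>The chain rule on the overlap of the charts, kept general in \<open>\<psi>\<close>: it
  yields the cocycle rule for transitions and the chart independence of directional
  derivatives.\<close>

lemma transition_comp:
  assumes c: "c \<in> charts_at M p" and d: "d \<in> charts_at M p"
    and \<psi>: "(\<psi> \<circ> chart_inv d has_derivative D) (at (chart_map d p))"
  shows "(\<psi> \<circ> chart_inv c has_derivative
      (\<lambda>x. D (frechet_derivative (chart_map d \<circ> chart_inv c) (at (chart_map c p)) x))) (at (chart_map c p))"
proof -
  have p: "(chart_map d \<circ> chart_inv c) (chart_map c p) = chart_map d p"
    using c by (simp add: charts_at_def chart_inv_map)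
  have "((\<lambda>u. (\<psi> \<circ> chart_inv d) ((chart_map d \<circ> chart_inv c) u)) has_derivative
     (\<lambda>x. D (frechet_derivative (chart_map d \<circ> chart_inv c) (at (chart_map c p)) x))) (at (chart_map c p))"
    using has_derivative_compose[OF transition_has_derivative[OF c d], of "\<psi> \<circ> chart_inv d" D] \<psi> p by simp
  then show ?thesis
    by (rule has_derivative_transform_within_open[of _ _ _ _ "chart_map c ` (chart_dom c \<inter> chart_dom d)"])
       (use c d in \<open>auto simp: charts_at_def chart_inv_map open_chart_image openin_chart_dom\<close>)
qed

lemma transition_chain:
  assumes "c \<in> charts_at M p" "d \<in> charts_at M p" "e \<in> charts_at M p"
  shows "frechet_derivative (chart_map e \<circ> chart_inv d) (at (chart_map d p))
      (frechet_derivative (chart_map d \<circ> chart_inv c) (at (chart_map c p)) x) =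
    frechet_derivative (chart_map e \<circ> chart_inv c) (at (chart_map c p)) x"
  by (simp add: frechet_derivative_eqI[OF transition_comp[OF assms(1,2) transition_has_derivative[OF assms(2,3)]]])

lemma tangent_transition:
  "v \<in> tangent_space M p \<Longrightarrow> c \<in> charts_at M p \<Longrightarrow> d \<in> charts_at M p \<Longrightarrow>
    frechet_derivative (chart_map d \<circ> chart_inv c) (at (chart_map c p)) (v c) = v d"
  unfolding tangent_space_def by (drule CollectD, drule conjunct1, drule bspec, assumption, drule bspec, assumption, erule sym)

lemma tangent_zero: "v \<in> tangent_space M p \<Longrightarrow> c \<notin> charts_at M p \<Longrightarrow> v c = 0"
  by (simp add: tangent_space_def)

lemma tangent_spaceI:
  assumes "\<And>c d. c \<in> charts_at M p \<Longrightarrow> d \<in> charts_at M p \<Longrightarrow>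
      v d = frechet_derivative (chart_map d \<circ> chart_inv c) (at (chart_map c p)) (v c)"
    and "\<And>c. c \<notin> charts_at M p \<Longrightarrow> v c = 0"
  shows "v \<in> tangent_space M p"
  using assms unfolding tangent_space_def by blast

lemma coord_vec_in: "c \<in> charts_at M p \<Longrightarrow> coord_vec M c p x c = x"
  by (simp add: coord_vec_def transition_self)

lemma coord_vec_tangent: "c \<in> charts_at M p \<Longrightarrow> coord_vec M c p x \<in> tangent_space M p"
  by (rule tangent_spaceI) (simp_all add: coord_vec_def transition_chain)

lemma coord_vec_tangent_eq: "v \<in> tangent_space M p \<Longrightarrow> c \<in> charts_at M p \<Longrightarrow> coord_vec M c p (v c) = v"
  by (simp add: coord_vec_def fun_eq_iff tangent_transition tangent_zero)

lemma coord_vec_lincomb: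
  "c \<in> charts_at M p \<Longrightarrow>
    coord_vec M c p (a *\<^sub>R x + b *\<^sub>R y) = (\<lambda>d. a *\<^sub>R coord_vec M c p x d + b *\<^sub>R coord_vec M c p y d)"
  by (auto simp: coord_vec_def fun_eq_iff linear_add[OF transition_linear] linear_cmul[OF transition_linear])

lemma tangent_lincomb:
  "v \<in> tangent_space M p \<Longrightarrow> w \<in> tangent_space M p \<Longrightarrow> (\<lambda>c. a *\<^sub>R v c + b *\<^sub>R w c) \<in> tangent_space M p"
  by (rule tangent_spaceI)
     (simp_all add: linear_add[OF transition_linear] linear_cmul[OF transition_linear] tangent_transition tangent_zero)

lemma vector_field_lincomb:
  assumes "vector_field M X" "vector_field M Y"
  shows "vector_field M (\<lambda>p c. a *\<^sub>R X p c + b *\<^sub>R Y p c)"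
proof -
  have "Ck_on k (chart_range c) (field_in c (\<lambda>p c. a *\<^sub>R X p c + b *\<^sub>R Y p c))" if "c \<in> atlas M" for c k
  proof -
    have "Ck_on k (chart_range c) (\<lambda>u. a *\<^sub>R field_in c X u + b *\<^sub>R field_in c Y u)"
      using assms that by (intro Ck_on_add Ck_on_linear_comp[OF _ bounded_linear_scaleR_right])
        (auto simp: vector_field_def smooth_on_def open_chart_range)
    then show ?thesis by (simp add: field_in_def[abs_def])
  qed
  then show ?thesis using assms by (auto simp: vector_field_def smooth_on_def tangent_lincomb)
qed

lemma field_in_differentiable:
  "vector_field M X \<Longrightarrow> c \<in> atlas M \<Longrightarrow> u \<in> chart_range c \<Longrightarrow> field_in c X differentiable (at u)"
  unfolding vector_field_def smooth_on_def by (metis Ck_on.simps(2))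

lemma fun_in_has_derivative:
  assumes "smooth_fun M f" "c \<in> charts_at M p"
  shows "(fun_in c f has_derivative frechet_derivative (fun_in c f) (at (chart_map c p))) (at (chart_map c p))"
  using assms charts_atD[OF assms(2)] chart_map_range unfolding smooth_fun_def smooth_on_def
  by (metis Ck_on_SucD)

text \<open>\<open>dir_deriv\<close> is computed in a chosen chart; the transition derivative in the
  chain rule is the one relating the components of v.\<close>

lemma dir_deriv_in:
  assumes f: "smooth_fun M f" and c: "c \<in> charts_at M p" and v: "v \<in> tangent_space M p"
  shows "dir_deriv M p v f = frechet_derivative (fun_in c f) (at (chart_map c p)) (v c)"
proof -
  let ?d = "some_chart M p"
  have d: "?d \<in> charts_at M p" using some_chart charts_at_points[OF c] by blast
  have "(f \<circ> chart_inv c has_derivative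
      (\<lambda>x. frechet_derivative (fun_in ?d f) (at (chart_map ?d p))
         (frechet_derivative (chart_map ?d \<circ> chart_inv c) (at (chart_map c p)) x))) (at (chart_map c p))"
    using transition_comp[OF c d] fun_in_has_derivative[OF f d] unfolding fun_in_def by blast
  then show ?thesis
    by (simp add: dir_deriv_def Let_def fun_in_def frechet_derivative_eqI tangent_transition[OF v c d])
qed

text \<open>The bump function vanishes outside a compact subset of the chart, so the extension by zero
  is smooth.\<close>

lemma vector_field_exists:
  assumes c: "c \<in> charts_at M p"
  obtains X where "vector_field M X" "X p c = x"
proof -
  note c' = charts_atD[OF c]
  obtain r where r: "r > 0" "cball (chart_map c p) r \<subseteq> chart_range c"
    using open_chart_range[OF c'(1)] chart_map_range[OF c'(2)] open_contains_cball by blast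
  obtain \<psi> where \<psi>: "\<And>k. Ck_on k UNIV \<psi>" "\<psi> (chart_map c p) = 1"
    "\<And>u. u \<notin> cball (chart_map c p) r \<Longrightarrow> \<psi> u = (0::real)"
    using smooth_bump[OF r(1)] by blast
  define X where "X q = (if q \<in> chart_dom c then coord_vec M c q (\<psi> (chart_map c q) *\<^sub>R x) else (\<lambda>d. 0))" for q
  define K where "K = chart_inv c ` cball (chart_map c p) r"
  \<comment> \<open>\<open>K\<close> is a continuous image of a compact ball, and compact sets are
    closed because the manifold is Hausdorff. The continuous inverse \<open>g\<close> supplied by
    the homeomorphism agrees with \<open>chart_inv\<close> on the chart range.\<close>
  have K: "closedin (topo M) K"
  proof -
    obtain g where g: "homeomorphic_maps (subtopology (topo M) (chart_dom c)) (top_of_set (chart_range c)) (chart_map c) g"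
      using homeomorphic_chart_map[OF c'(1)] homeomorphic_map_maps by blast
    have "g u = chart_inv c u" if "u \<in> chart_range c" for u
    proof -
      have "g (chart_map c (chart_inv c u)) = chart_inv c u"
        using g chart_inv_dom[OF that] chart_dom_subset[OF c'(1)] by (auto simp: homeomorphic_maps_def)
      then show ?thesis by (simp add: chart_map_inv[OF that])
    qed
    then have "K = g ` cball (chart_map c p) r" unfolding K_def using r(2) by (intro image_cong) auto
    moreover have "continuous_map (top_of_set (chart_range c)) (topo M) g"
      using g by (auto simp: homeomorphic_maps_def continuous_map_in_subtopology)
    moreover have "compactin (top_of_set (chart_range c)) (cball (chart_map c p) r)"
      using r(2) by (simp add: compactin_subtopology)
    ultimately have "compactin (topo M) K" using image_compactin by blast
    then show ?thesis using smooth_manifold compactin_imp_closedin by (auto simp: smooth_manifold_def)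
  qed
  have X0: "X q = (\<lambda>d. 0)" if "q \<notin> K" for q
  proof (cases "q \<in> chart_dom c")
    case True
    then have "chart_map c q \<notin> cball (chart_map c p) r"
      using that chart_inv_map[OF c'(1) True] unfolding K_def by force
    then have "\<psi> (chart_map c q) = 0" using \<psi>(3) by blast
    moreover have "c \<in> charts_at M q" using c'(1) True by (simp add: charts_at_def)
    ultimately show ?thesis using True
      by (auto simp: X_def coord_vec_def fun_eq_iff linear_0[OF transition_linear])
  qed (simp add: X_def)
  have "Ck_on k (chart_range e) (field_in e X)" if e: "e \<in> atlas M" for e k
  proof -
    let ?V = "chart_map e ` (chart_dom e \<inter> chart_dom c)"
    let ?W = "chart_map e ` (chart_dom e \<inter> (points M - K))"
    have openV: "open ?V" using open_chart_image[OF e openin_chart_dom[OF c'(1)]] .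
    have openW: "open ?W" by (rule open_chart_image[OF e openin_diff[OF openin_topspace K]])
    have open2: "open (chart_map c ` (chart_dom c \<inter> chart_dom e))"
      using open_chart_image[OF c'(1) openin_chart_dom[OF e]] .
    have t1: "Ck_on k ?V (chart_map c \<circ> chart_inv e)" by (rule transition_smooth[OF e c'(1)])
    have t2: "Ck_on k (chart_map c ` (chart_dom c \<inter> chart_dom e))
        (\<lambda>u. frechet_derivative (chart_map e \<circ> chart_inv c) (at u) x)"
      using transition_smooth[OF c'(1) e, of "Suc k"] by simp
    have sub: "(chart_map c \<circ> chart_inv e) ` ?V \<subseteq> chart_map c ` (chart_dom c \<inter> chart_dom e)"
      by (auto simp: chart_inv_map[OF e])
    have "Ck_on k ?V (\<lambda>u. \<psi> ((chart_map c \<circ> chart_inv e) u) *\<^sub>R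
        frechet_derivative (chart_map e \<circ> chart_inv c) (at ((chart_map c \<circ> chart_inv e) u)) x)"
      by (rule Ck_on_scaleR[OF openV Ck_on_compose[OF openV open_UNIV subset_UNIV t1 \<psi>(1)]
            Ck_on_compose[OF openV open2 sub t1 t2]])
    then have V: "Ck_on k ?V (field_in e X)"
    proof (rule Ck_on_cong[OF openV, rotated])
      fix u assume "u \<in> ?V"
      then obtain q where q: "q \<in> chart_dom e" "q \<in> chart_dom c" "u = chart_map e q" by auto
      then have "c \<in> charts_at M q" "e \<in> charts_at M q" using c'(1) e by (auto simp: charts_at_def)
      then show "\<psi> ((chart_map c \<circ> chart_inv e) u) *\<^sub>R
        frechet_derivative (chart_map e \<circ> chart_inv c) (at ((chart_map c \<circ> chart_inv e) u)) x = field_in e X u"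
        using q by (simp add: field_in_def X_def chart_inv_map[OF e] coord_vec_def linear_cmul[OF transition_linear])
    qed
    have W: "Ck_on k ?W (field_in e X)"
      by (rule Ck_on_cong[OF openW _ Ck_on_const[of k ?W 0]]) (auto simp: field_in_def chart_inv_map[OF e] X0)
    \<comment> \<open>Hence the domain of c and the complement of \<open>K\<close> cover the
      manifold: \<open>X\<close> is given by the bump formula on one and is 0 on the other.\<close>
    have "K \<subseteq> chart_dom c" unfolding K_def by (intro image_subsetI chart_inv_dom subsetD[OF r(2)])
    then have "chart_dom e = (chart_dom e \<inter> chart_dom c) \<union> (chart_dom e \<inter> (points M - K))"
      using chart_dom_subset[OF e] by blast
    then have "chart_range e = ?V \<union> ?W"
      unfolding chart_range_def by (metis image_Un)
    then show ?thesis using Ck_on_Un[OF openV openW V W] by simp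
  qed
  moreover have "X q \<in> tangent_space M q" for q
  proof (cases "q \<in> chart_dom c")
    case True
    then show ?thesis using c'(1) by (simp add: X_def coord_vec_tangent charts_at_def)
  next
    case False
    then show ?thesis by (intro tangent_spaceI) (simp_all add: X_def linear_0[OF transition_linear])
  qed
  ultimately have "vector_field M X" by (auto simp: vector_field_def smooth_on_def)
  moreover have "X p c = x" using c' by (simp add: X_def \<psi>(2) coord_vec_in[OF c])
  ultimately show ?thesis using that by blast
qed

end

section \<open>Pseudo-Riemannian metrics and gradients read in charts\<close>

locale pseudo_riemannian_mfd = smooth_mfd M for M :: "('a, 'e::euclidean_space) manifold" +
  fixes g :: "('a, 'e) metric"
  assumes pseudo_riemannian: "pseudo_riemannian M g"
begin

lemma
  assumes "p \<in> points M" "v \<in> tangent_space M p" "w \<in> tangent_space M p"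
  shows g_sym: "g p v w = g p w v"
    and g_lincomb: "v' \<in> tangent_space M p \<Longrightarrow>
      g p (\<lambda>c. a *\<^sub>R v c + b *\<^sub>R v' c) w = a * g p v w + b * g p v' w"
  using pseudo_riemannian assms by (auto simp: pseudo_riemannian_def)

lemma g_nondegenerate:
  "p \<in> points M \<Longrightarrow> v \<in> tangent_space M p \<Longrightarrow> (\<And>w. w \<in> tangent_space M p \<Longrightarrow> g p v w = 0) \<Longrightarrow> v = (\<lambda>c. 0)"
  using pseudo_riemannian unfolding pseudo_riemannian_def by blast

lemma metric_in_eq:
  assumes "c \<in> charts_at M p" "v \<in> tangent_space M p" "w \<in> tangent_space M p"
  shows "metric_in M g c (chart_map c p) (v c) (w c) = g p v w"
  using assms charts_atD[OF assms(1)]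
  by (simp add: metric_in_def chart_inv_map coord_vec_tangent_eq)

text \<open>\<open>coord_vec\<close> is linear and reaches every tangent vector, so the pointwise
  properties of g carry over to components.\<close>

lemma local_metric_in:
  assumes c: "c \<in> atlas M"
  shows "local_metric (chart_range c) (metric_in M g c)"
proof
  show "open (chart_range c)" using c by (rule open_chart_range)
  fix u assume "u \<in> chart_range c"
  then have c': "c \<in> charts_at M (chart_inv c u)" using c by (rule chart_inv_charts_at[rotated])
  note p = charts_at_points[OF c'] and t = coord_vec_tangent[OF c']
  show sym: "metric_in M g c u x y = metric_in M g c u y x" for x y
    by (simp add: metric_in_def g_sym[OF p t t, of x y])
  have lin: "metric_in M g c u (a *\<^sub>R x + b *\<^sub>R y) z = a * metric_in M g c u x z + b * metric_in M g c u y z" for a b x y z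
    by (simp add: metric_in_def Let_def coord_vec_lincomb[OF c'] g_lincomb[OF p t t t])
  have "linear (\<lambda>x. metric_in M g c u x y)" for y
  proof (rule linearI)
    show "metric_in M g c u (x + x') y = metric_in M g c u x y + metric_in M g c u x' y" for x x'
      using lin[of 1 x 1 x' y] by simp
    show "metric_in M g c u (a *\<^sub>R x) y = a *\<^sub>R metric_in M g c u x y" for a x
      using lin[of a x 0 0 y] by simp
  qed
  moreover have "metric_in M g c u x = (\<lambda>y. metric_in M g c u y x)" for x
    using sym[of x] by (rule ext)
  ultimately show "bilinear (metric_in M g c u)"
    unfolding bilinear_def by metis
  show "v = 0" if "\<And>w. metric_in M g c u v w = 0" for v
  proof -
    have "coord_vec M c (chart_inv c u) v = (\<lambda>c. 0)"
    proof (rule g_nondegenerate[OF p t])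
      fix w assume w: "w \<in> tangent_space M (chart_inv c u)"
      show "g (chart_inv c u) (coord_vec M c (chart_inv c u) v) w = 0"
        using that[of "w c"] by (simp add: metric_in_def Let_def coord_vec_tangent_eq[OF w c'])
    qed
    then show "v = 0" using coord_vec_in[OF c', of v] by simp
  qed
next
  show "Ck_on 2 (chart_range c) (\<lambda>u. metric_in M g c u x y)" for x y
    using pseudo_riemannian c by (auto simp: pseudo_riemannian_def smooth_on_def)
qed

text \<open>\<open>gradient\<close> is a definite description: the vector is found in a chart by
  representing the differential of f, and nondegeneracy makes it unique.\<close>

lemma gradient_in:
  assumes f: "smooth_fun M f" and p: "p \<in> points M"
  shows "gradient M g f p \<in> tangent_space M p"
    and "w \<in> tangent_space M p \<Longrightarrow> g p (gradient M g f p) w = dir_deriv M p w f"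
proof -
  obtain c where c: "c \<in> charts_at M p" using some_chart[OF p] by blast
  note c' = charts_atD[OF c]
  interpret local_metric "chart_range c" "metric_in M g c" using local_metric_in[OF c'(1)] .
  note u = chart_map_range[OF c'(2)]
  have "linear (frechet_derivative (fun_in c f) (at (chart_map c p)))"
    using fun_in_has_derivative[OF f c] by (rule has_derivative_linear)
  from nondegenerate_represent[OF bil[OF u] nondeg[OF u] this] obtain x where
    x: "\<And>y. metric_in M g c (chart_map c p) x y = frechet_derivative (fun_in c f) (at (chart_map c p)) y" by blast
  have "\<exists>!v. v \<in> tangent_space M p \<and> (\<forall>w\<in>tangent_space M p. g p v w = dir_deriv M p w f)"
  proof (rule ex1I[of _ "coord_vec M c p x"])
    show "coord_vec M c p x \<in> tangent_space M p \<and> (\<forall>w\<in>tangent_space M p. g p (coord_vec M c p x) w = dir_deriv M p w f)"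
      using metric_in_eq[OF c coord_vec_tangent[OF c]]
      by (auto simp: coord_vec_tangent[OF c] coord_vec_in[OF c] x dir_deriv_in[OF f c] simp flip: metric_in_eq[OF c])
    fix v assume v: "v \<in> tangent_space M p \<and> (\<forall>w\<in>tangent_space M p. g p v w = dir_deriv M p w f)"
    have "v c = x"
    proof (rule metric_eqI[OF u])
      fix y
      note t = coord_vec_tangent[OF c, of y]
      show "metric_in M g c (chart_map c p) (v c) y = metric_in M g c (chart_map c p) x y"
        using metric_in_eq[OF c _ t, of v] v t by (simp add: x coord_vec_in[OF c] dir_deriv_in[OF f c])
    qed
    then show "v = coord_vec M c p x" using coord_vec_tangent_eq[OF _ c, of v] v by simp
  qed
  from theI'[OF this] show "gradient M g f p \<in> tangent_space M p"
    and "w \<in> tangent_space M p \<Longrightarrow> g p (gradient M g f p) w = dir_deriv M p w f"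
    unfolding gradient_def by auto
qed

lemma local_gradient_in:
  assumes f: "smooth_fun M f" and c: "c \<in> atlas M"
  shows "local_gradient (chart_range c) (metric_in M g c) (fun_in c f) (field_in c (gradient M g f))"
proof -
  interpret local_metric "chart_range c" "metric_in M g c" using local_metric_in[OF c] .
  show ?thesis
  proof
    show "Ck_on 2 (chart_range c) (fun_in c f)" using f c by (auto simp: smooth_fun_def smooth_on_def)
    fix u z assume u: "u \<in> chart_range c"
    have c': "c \<in> charts_at M (chart_inv c u)" using c u by (rule chart_inv_charts_at)
    note p = charts_at_points[OF c'] and t = coord_vec_tangent[OF c', of z]
    show "metric_in M g c u (field_in c (gradient M g f) u) z = frechet_derivative (fun_in c f) (at u) z"
      using metric_in_eq[OF c' gradient_in(1)[OF f p] t] gradient_in(2)[OF f p t]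
      by (simp add: dir_deriv_in[OF f c' t] chart_map_inv[OF u] coord_vec_in[OF c'] field_in_def)
  qed
qed

end

section \<open>Charts of the warped product\<close>

lemma prod_chart_simps [simp]:
  "chart_dom (prod_chart c d) = chart_dom c \<times> chart_dom d"
  "chart_map (prod_chart c d) = map_prod (chart_map c) (chart_map d)"
  "chart_range (prod_chart c d) = chart_range c \<times> chart_range d"
  by (auto simp: prod_chart_def chart_range_def)

text \<open>That the product is a smooth manifold with a pseudo-Riemannian metric is an assumption
  of the locale; it is part of what a soliton on the product asserts.\<close>

locale warped_mfd = B: pseudo_riemannian_mfd M1 g1 + F: pseudo_riemannian_mfd M2 g2 +
    P: pseudo_riemannian_mfd "prod_manifold M1 M2" "warped_metric M1 g1 f M2 g2"
  for M1 :: "('a, 'e::euclidean_space) manifold" and g1 and f :: "'a \<Rightarrow> real"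
    and M2 :: "('b, 'f::euclidean_space) manifold" and g2 +
  assumes f: "smooth_fun M1 f" and f_pos: "p \<in> points M1 \<Longrightarrow> f p > 0"
begin

abbreviation "M \<equiv> prod_manifold M1 M2"
abbreviation "g \<equiv> warped_metric M1 g1 f M2 g2"
abbreviation "grad \<equiv> gradient M1 g1 f"

lemma prod_chart_at:
  "c \<in> charts_at M1 p \<Longrightarrow> d \<in> charts_at M2 q \<Longrightarrow> prod_chart c d \<in> charts_at M (p, q)"
  by (auto simp: charts_at_def prod_manifold_def)

lemma charts_at_prodE:
  assumes "C \<in> charts_at M (p, q)"
  obtains c d where "C = prod_chart c d" "c \<in> charts_at M1 p" "d \<in> charts_at M2 q"
  using assms by (auto simp: charts_at_def prod_manifold_def)

lemma chart_inv_prod: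
  assumes "c \<in> atlas M1" "d \<in> atlas M2" "u \<in> chart_range c" "v \<in> chart_range d"
  shows "chart_inv (prod_chart c d) (u, v) = (chart_inv c u, chart_inv d v)"
proof -
  have "prod_chart c d \<in> atlas M" using assms by (auto simp: prod_manifold_def)
  from P.chart_inv_map[OF this, of "(chart_inv c u, chart_inv d v)"] show ?thesis
    using assms by (simp add: B.chart_inv_dom F.chart_inv_dom B.chart_map_inv F.chart_map_inv)
qed

lemma has_derivative_at_prod_chart:
  assumes c: "c \<in> charts_at M1 p" and d: "d \<in> charts_at M2 q"
    and D: "(\<psi> has_derivative D) (at (chart_map c p, chart_map d q))"
    and eq: "\<And>u v. u \<in> chart_range c \<Longrightarrow> v \<in> chart_range d \<Longrightarrow> \<psi> (u, v) = \<psi>' (chart_inv c u, chart_inv d v)"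
  shows "frechet_derivative (\<psi>' \<circ> chart_inv (prod_chart c d)) (at (chart_map c p, chart_map d q)) = D"
proof (rule frechet_derivative_eqI, rule has_derivative_transform_within_open[OF D])
  note c' = B.charts_atD[OF c] and d' = F.charts_atD[OF d]
  show "open (chart_range c \<times> chart_range d)"
    using c'(1) d'(1) by (intro open_Times B.open_chart_range F.open_chart_range)
  show "(chart_map c p, chart_map d q) \<in> chart_range c \<times> chart_range d"
    using c' d' by (simp add: chart_range_def)
  show "\<psi> w = (\<psi>' \<circ> chart_inv (prod_chart c d)) w" if "w \<in> chart_range c \<times> chart_range d" for w
    using that by (cases w) (simp add: eq chart_inv_prod[OF c'(1) d'(1)])
qed

lemma coord_vec_prod:
  assumes c: "c \<in> charts_at M1 p" "c' \<in> charts_at M1 p" and d: "d \<in> charts_at M2 q" "d' \<in> charts_at M2 q"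
  shows "coord_vec M (prod_chart c d) (p, q) (x, y) (prod_chart c' d') =
    (frechet_derivative (chart_map c' \<circ> chart_inv c) (at (chart_map c p)) x,
     frechet_derivative (chart_map d' \<circ> chart_inv d) (at (chart_map d q)) y)"
proof -
  have "frechet_derivative (map_prod (chart_map c') (chart_map d') \<circ> chart_inv (prod_chart c d))
      (at (chart_map c p, chart_map d q)) =
    (\<lambda>X. (frechet_derivative (chart_map c' \<circ> chart_inv c) (at (chart_map c p)) (fst X),
     frechet_derivative (chart_map d' \<circ> chart_inv d) (at (chart_map d q)) (snd X)))"
    by (rule has_derivative_at_prod_chart[OF c(1) d(1) has_derivative_Pair[OF
            has_derivative_fst_comp[OF B.transition_has_derivative[OF c]]
            has_derivative_snd_comp[OF F.transition_has_derivative[OF d]]]]) simp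
  then show ?thesis
    using prod_chart_at[OF c(2) d(2)] by (simp add: coord_vec_def)
qed

text \<open>\<open>tangent_map\<close> uses the chart chosen at (p, q), which is some product chart
  but maybe not the given one; \<open>transition_chain\<close> in each factor removes the
  difference.\<close>

lemma
  assumes c: "c \<in> charts_at M1 p" and d: "d \<in> charts_at M2 q"
  shows tangent_map_fst: "tangent_map M M1 fst (p, q) (coord_vec M (prod_chart c d) (p, q) (x, y)) = coord_vec M1 c p x"
    and tangent_map_snd: "tangent_map M M2 snd (p, q) (coord_vec M (prod_chart c d) (p, q) (x, y)) = coord_vec M2 d q y"
proof -
  have "(p, q) \<in> points M" using P.charts_at_points[OF prod_chart_at[OF c d]] .
  then obtain c' d' where C: "some_chart M (p, q) = prod_chart c' d'" and c': "c' \<in> charts_at M1 p"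
    and d': "d' \<in> charts_at M2 q"
    using P.some_chart charts_at_prodE by metis
  have "frechet_derivative (chart_map e \<circ> fst \<circ> chart_inv (prod_chart c' d')) (at (chart_map c' p, chart_map d' q)) =
    (\<lambda>X. frechet_derivative (chart_map e \<circ> chart_inv c') (at (chart_map c' p)) (fst X))" if "e \<in> charts_at M1 p" for e
    by (rule has_derivative_at_prod_chart[OF c' d' has_derivative_fst_comp[OF B.transition_has_derivative[OF c' that]]]) simp
  then show "tangent_map M M1 fst (p, q) (coord_vec M (prod_chart c d) (p, q) (x, y)) = coord_vec M1 c p x"
    by (simp add: tangent_map_def Let_def C fun_eq_iff coord_vec_prod[OF c c' d d'] B.transition_chain[OF c c'])
       (simp add: coord_vec_def)
  have "frechet_derivative (chart_map e \<circ> snd \<circ> chart_inv (prod_chart c' d')) (at (chart_map c' p, chart_map d' q)) =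
    (\<lambda>X. frechet_derivative (chart_map e \<circ> chart_inv d') (at (chart_map d' q)) (snd X))" if "e \<in> charts_at M2 q" for e
    by (rule has_derivative_at_prod_chart[OF c' d' has_derivative_snd_comp[OF F.transition_has_derivative[OF d' that]]]) simp
  then show "tangent_map M M2 snd (p, q) (coord_vec M (prod_chart c d) (p, q) (x, y)) = coord_vec M2 d q y"
    by (simp add: tangent_map_def Let_def C fun_eq_iff coord_vec_prod[OF c c' d d'] F.transition_chain[OF d d'])
       (simp add: coord_vec_def)
qed

lemma metric_in_warped:
  assumes "c \<in> atlas M1" "d \<in> atlas M2" "u \<in> chart_range c" "v \<in> chart_range d"
  shows "metric_in M g (prod_chart c d) (u, v) X Y =
    metric_in M1 g1 c u (fst X) (fst Y) + (fun_in c f u)\<^sup>2 * metric_in M2 g2 d v (snd X) (snd Y)"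
proof -
  note c = B.chart_inv_charts_at[OF assms(1,3)] and d = F.chart_inv_charts_at[OF assms(2,4)]
  have "tangent_map M M1 fst (chart_inv c u, chart_inv d v)
        (coord_vec M (prod_chart c d) (chart_inv c u, chart_inv d v) Z) = coord_vec M1 c (chart_inv c u) (fst Z)"
    "tangent_map M M2 snd (chart_inv c u, chart_inv d v)
        (coord_vec M (prod_chart c d) (chart_inv c u, chart_inv d v) Z) = coord_vec M2 d (chart_inv d v) (snd Z)" for Z
    using tangent_map_fst[OF c d, of "fst Z" "snd Z"] tangent_map_snd[OF c d, of "fst Z" "snd Z"] by simp_all
  then show ?thesis
    by (simp add: metric_in_def Let_def chart_inv_prod[OF assms] warped_metric_def pullback_def fun_in_def)
qed

lemma lift1_in:
  assumes X: "vector_field M1 X" and c: "c \<in> charts_at M1 p" and d: "d \<in> charts_at M2 q"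
  shows "lift1 M1 M2 X (p, q) (prod_chart c d) = (X p c, 0)"
proof -
  let ?c = "some_chart M1 p"
  have c': "?c \<in> charts_at M1 p" using B.some_chart[OF B.charts_at_points[OF c]] .
  have Xp: "X p \<in> tangent_space M1 p" using X B.charts_at_points[OF c] by (simp add: vector_field_def)
  have "frechet_derivative (map_prod (chart_map c) (chart_map d) \<circ> (\<lambda>p. (p, q)) \<circ> chart_inv ?c) (at (chart_map ?c p)) =
    (\<lambda>x. (frechet_derivative (chart_map c \<circ> chart_inv ?c) (at (chart_map ?c p)) x, 0))"
    using has_derivative_Pair[OF B.transition_has_derivative[OF c' c] has_derivative_const[of "chart_map d q"]]
    by (intro frechet_derivative_eqI) (simp add: o_def)
  then show ?thesis
    using prod_chart_at[OF c d] by (simp add: lift1_def tangent_map_def Let_def B.tangent_transition[OF Xp c' c])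
qed

lemma lift2_in:
  assumes Y: "vector_field M2 Y" and c: "c \<in> charts_at M1 p" and d: "d \<in> charts_at M2 q"
  shows "lift2 M1 M2 Y (p, q) (prod_chart c d) = (0, Y q d)"
proof -
  let ?d = "some_chart M2 q"
  have d': "?d \<in> charts_at M2 q" using F.some_chart[OF F.charts_at_points[OF d]] .
  have Yq: "Y q \<in> tangent_space M2 q" using Y F.charts_at_points[OF d] by (simp add: vector_field_def)
  have "frechet_derivative (map_prod (chart_map c) (chart_map d) \<circ> (\<lambda>q. (p, q)) \<circ> chart_inv ?d) (at (chart_map ?d q)) =
    (\<lambda>x. (0, frechet_derivative (chart_map d \<circ> chart_inv ?d) (at (chart_map ?d q)) x))"
    using has_derivative_Pair[OF has_derivative_const[of "chart_map c p"] F.transition_has_derivative[OF d' d]]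
    by (intro frechet_derivative_eqI) (simp add: o_def)
  then show ?thesis
    using prod_chart_at[OF c d] by (simp add: lift2_def tangent_map_def Let_def F.tangent_transition[OF Yq d' d])
qed

lemma local_warped_in:
  assumes c: "c \<in> atlas M1" and d: "d \<in> atlas M2"
  shows "local_warped (chart_range c) (metric_in M1 g1 c) (fun_in c f) (field_in c grad)
    (chart_range d) (metric_in M2 g2 d) (metric_in M g (prod_chart c d))"
proof -
  interpret B1: local_gradient "chart_range c" "metric_in M1 g1 c" "fun_in c f" "field_in c grad"
    using B.local_gradient_in[OF f c] .
  interpret F1: local_metric "chart_range d" "metric_in M2 g2 d" using F.local_metric_in[OF d] .
  show ?thesis
  proof
    show "fun_in c f u > 0" if "u \<in> chart_range c" for u
      using f_pos[OF B.charts_at_points[OF B.chart_inv_charts_at[OF c that]]] by (simp add: fun_in_def)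
  qed (rule metric_in_warped[OF c d])
qed

text \<open>The soliton equation in a product chart, on pairs of base vectors and on pairs of fibre
  vectors, with the warped Lie derivative and Ricci tensor substituted. The second equation holds at
  each single p, where all base quantities are just numbers.\<close>

lemma soliton_in:
  assumes sol: "ricci_soliton M g (\<lambda>m c. lift1 M1 M2 \<zeta>1 m c + lift2 M1 M2 \<zeta>2 m c) l"
    and X1: "vector_field M1 \<zeta>1" and X2: "vector_field M2 \<zeta>2"
    and c: "c \<in> charts_at M1 p" and d: "d \<in> charts_at M2 q"
  shows "1/2 * lie_metric (metric_in M1 g1 c) (field_in c \<zeta>1) (chart_map c p) y z
      + ricci (metric_in M1 g1 c) (chart_map c p) y z
      - real DIM('f) / f p * metric_in M1 g1 c (chart_map c p) (cov (metric_in M1 g1 c) (\<lambda>_. y) (field_in c grad) (chart_map c p)) z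
    = l * metric_in M1 g1 c (chart_map c p) y z"  (is ?base)
  and "f p * frechet_derivative (fun_in c f) (at (chart_map c p)) (\<zeta>1 p c) * metric_in M2 g2 d (chart_map d q) y' z'
      + 1/2 * (f p)\<^sup>2 * lie_metric (metric_in M2 g2 d) (field_in d \<zeta>2) (chart_map d q) y' z'
      + ricci (metric_in M2 g2 d) (chart_map d q) y' z'
      - (f p * lin_trace (\<lambda>x. cov (metric_in M1 g1 c) (\<lambda>_. x) (field_in c grad) (chart_map c p))
         + (real DIM('f) - 1) * metric_in M1 g1 c (chart_map c p) (grad p c) (grad p c)) * metric_in M2 g2 d (chart_map d q) y' z'
    = l * (f p)\<^sup>2 * metric_in M2 g2 d (chart_map d q) y' z'"  (is ?fibre)
proof -
  note c' = B.charts_atD[OF c] and d' = F.charts_atD[OF d]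
  note u = B.chart_map_range[OF c'(2)] and v = F.chart_map_range[OF d'(2)]
  interpret L: local_warped "chart_range c" "metric_in M1 g1 c" "fun_in c f" "field_in c grad"
    "chart_range d" "metric_in M2 g2 d" "metric_in M g (prod_chart c d)"
    using local_warped_in[OF c'(1) d'(1)] .
  let ?C = "prod_chart c d" and ?H = "metric_in M g (prod_chart c d)" and ?w = "(chart_map c p, chart_map d q)"
  let ?\<xi> = "field_in ?C (\<lambda>m c. lift1 M1 M2 \<zeta>1 m c + lift2 M1 M2 \<zeta>2 m c)"
  note C = prod_chart_at[OF c d]
  have \<xi>: "?\<xi> (u, v) = (field_in c \<zeta>1 u, field_in d \<zeta>2 v)" if "u \<in> chart_range c" "v \<in> chart_range d" for u v
    using lift1_in[OF X1 B.chart_inv_charts_at[OF c'(1) that(1)] F.chart_inv_charts_at[OF d'(1) that(2)]]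
      lift2_in[OF X2 B.chart_inv_charts_at[OF c'(1) that(1)] F.chart_inv_charts_at[OF d'(1) that(2)]]
    by (simp add: field_in_def chart_inv_prod[OF c'(1) d'(1) that])
  \<comment> \<open>Every pair of coordinate vectors is realised by tangent vectors of the product
    through \<open>coord_vec\<close>.\<close>
  have eq: "1/2 * lie_metric ?H ?\<xi> ?w X Y + ricci ?H ?w X Y = l * ?H ?w X Y" for X Y
  proof -
    note t = P.coord_vec_tangent[OF C]
    have "1/2 * lie_metric ?H ?\<xi> ?w (coord_vec M ?C (p, q) X ?C) (coord_vec M ?C (p, q) Y ?C)
        + ricci ?H ?w (coord_vec M ?C (p, q) X ?C) (coord_vec M ?C (p, q) Y ?C)
      = l * g (p, q) (coord_vec M ?C (p, q) X) (coord_vec M ?C (p, q) Y)"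
      using sol P.charts_at_points[OF C] C t[of X] t[of Y] unfolding ricci_soliton_def by force
    then show ?thesis
      using P.metric_in_eq[OF C t[of X] t[of Y]] by (simp add: P.coord_vec_in[OF C])
  qed
  note lie = L.lie_warped[OF u v B.field_in_differentiable[OF X1 c'(1) u] F.field_in_differentiable[OF X2 d'(1) v] \<xi>]
  have p: "fun_in c f (chart_map c p) = f p" "field_in c \<zeta>1 (chart_map c p) = \<zeta>1 p c"
     "field_in c grad (chart_map c p) = grad p c"
    using c' by (simp_all add: fun_in_def field_in_def B.chart_inv_map)
  show ?base
    using eq[of "(y, 0)" "(z, 0)"]
    by (simp add: lie(1) L.ricci_warped_base[OF u v] L.H[OF u v] L.F.metric_simps[OF v] p cov_def)
  show ?fibre
    using eq[of "(0, y')" "(0, z')"]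
    by (simp add: lie(2) L.ricci_warped_fibre[OF u v] L.H[OF u v] L.B.metric_simps[OF u] p cov_def algebra_simps)
qed

text \<open>The vector representing h(\<open>cov\<close> a, -) through h is \<open>cov\<close> a
  itself, so the metric trace of the Hessian is the plain trace of the covariant derivative of the
  gradient. The chart is the one in which \<open>laplacian\<close> is evaluated.\<close>

lemma f_sharp_eq:
  fixes n :: nat
  assumes p: "p \<in> points M1"
  defines "c \<equiv> some_chart M1 p"
  shows "f_sharp n M1 g1 f p =
    f p * lin_trace (\<lambda>x. cov (metric_in M1 g1 c) (\<lambda>_. x) (field_in c grad) (chart_map c p))
      + (real n - 1) * metric_in M1 g1 c (chart_map c p) (grad p c) (grad p c)"
proof -
  have c: "c \<in> charts_at M1 p" unfolding c_def using B.some_chart[OF p] .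
  interpret L: local_metric "chart_range c" "metric_in M1 g1 c"
    using B.local_metric_in[OF B.charts_atD(1)[OF c]] .
  note u = B.chart_map_range[OF B.charts_atD(2)[OF c]]
  have "(THE z. \<forall>y. metric_in M1 g1 c (chart_map c p) z y = metric_in M1 g1 c (chart_map c p) a y) = a" for a
    using L.metric_eqI[OF u] by (intro the_equality) blast+
  then have "laplacian M1 g1 f p = lin_trace (\<lambda>x. cov (metric_in M1 g1 c) (\<lambda>_. x) (field_in c grad) (chart_map c p))"
    by (simp add: laplacian_def Let_def metric_trace_def hessian_in_def c_def[symmetric])
  then show ?thesis
    using B.gradient_in(1)[OF f p] by (simp add: f_sharp_def B.metric_in_eq[OF c])
qed

lemma base_soliton:
  assumes sol: "ricci_soliton M g (\<lambda>m c. lift1 M1 M2 \<zeta>1 m c + lift2 M1 M2 \<zeta>2 m c) l"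
    and X1: "vector_field M1 \<zeta>1" and X2: "vector_field M2 \<zeta>2" and X: "vector_field M1 \<eta>"
    and eta: "\<And>X1 p. vector_field M1 X1 \<Longrightarrow> p \<in> points M1 \<Longrightarrow>
      (\<lambda>c. (real DIM('f) / f p) *\<^sub>R cov_deriv M1 g1 X1 grad p c) = cov_deriv M1 g1 X1 \<eta> p"
  shows "ricci_soliton M1 g1 (\<lambda>p c. \<zeta>1 p c - \<eta> p c) l"
  unfolding ricci_soliton_def
proof (intro conjI ballI)
  show "pseudo_riemannian M1 g1" by (rule B.pseudo_riemannian)
  show "vector_field M1 (\<lambda>p c. \<zeta>1 p c - \<eta> p c)"
    using B.vector_field_lincomb[OF X1 X, of 1 "-1"] by simp
  fix p c v w assume p: "p \<in> points M1" and c: "c \<in> charts_at M1 p"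
    and v: "v \<in> tangent_space M1 p" and w: "w \<in> tangent_space M1 p"
  note c' = B.charts_atD[OF c]
  note u = B.chart_map_range[OF c'(2)]
  interpret L: local_gradient "chart_range c" "metric_in M1 g1 c" "fun_in c f" "field_in c grad"
    using B.local_gradient_in[OF f c'(1)] .
  \<comment> \<open>The split equation lives on the product, so a chart around some point of the
    fibre must be supplied; the base equation does not mention it.\<close>
  have "points M2 \<noteq> {}" using F.smooth_manifold unfolding smooth_manifold_def by (rule conjunct1)
  then obtain q where "q \<in> points M2" by blast
  then have d: "some_chart M2 q \<in> charts_at M2 q" by (rule F.some_chart)
  let ?h = "metric_in M1 g1 c" and ?u = "chart_map c p"
  \<comment> \<open>\<open>cov\<close> depends on its first field only through the value at the
    point, so a global field with value x at p in chart c turns the hypothesis into a statement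
    about x.\<close>
  have cov_eta: "(real DIM('f) / f p) *\<^sub>R cov ?h (\<lambda>_. x) (field_in c grad) ?u = cov ?h (\<lambda>_. x) (field_in c \<eta>) ?u" for x
  proof -
    obtain X where X: "vector_field M1 X" "X p c = x" using B.vector_field_exists[OF c] .
    have "field_in c X ?u = x" using X(2) c' by (simp add: field_in_def B.chart_inv_map)
    then show ?thesis using fun_cong[OF eta[OF X(1) p], of c] c by (simp add: cov_deriv_def cov_def)
  qed
  have D: "frechet_derivative (field_in c (\<lambda>p c. \<zeta>1 p c - \<eta> p c)) (at ?u) =
      (\<lambda>x. frechet_derivative (field_in c \<zeta>1) (at ?u) x - frechet_derivative (field_in c \<eta>) (at ?u) x)"
    using has_derivative_diff[OF has_frechet_derivative[OF B.field_in_differentiable[OF X1 c'(1) u]]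
        has_frechet_derivative[OF B.field_in_differentiable[OF X c'(1) u]]]
    by (intro frechet_derivative_eqI) (simp add: field_in_def[abs_def])
  have N: "field_in c (\<lambda>p c. \<zeta>1 p c - \<eta> p c) ?u = field_in c \<zeta>1 ?u - field_in c \<eta> ?u"
    by (simp add: field_in_def)
  have "lie_metric ?h (field_in c (\<lambda>p c. \<zeta>1 p c - \<eta> p c)) ?u (v c) (w c) =
      lie_metric ?h (field_in c \<zeta>1) ?u (v c) (w c) - lie_metric ?h (field_in c \<eta>) ?u (v c) (w c)"
    unfolding L.lie_metric_eq[OF u] D N
    by (simp add: L.metric_simps[OF u] bilinear_rsub[OF L.bilinear_christoffel[OF u]])
  also have "lie_metric ?h (field_in c \<eta>) ?u (v c) (w c) =
      2 * (real DIM('f) / f p * ?h ?u (cov ?h (\<lambda>_. v c) (field_in c grad) ?u) (w c))"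
  proof -
    have "lie_metric ?h (field_in c \<eta>) ?u (v c) (w c) =
       ?h ?u (cov ?h (\<lambda>_. v c) (field_in c \<eta>) ?u) (w c) + ?h ?u (v c) (cov ?h (\<lambda>_. w c) (field_in c \<eta>) ?u)"
      by (simp add: L.lie_metric_eq[OF u] cov_def)
    also have "\<dots> = real DIM('f) / f p * (?h ?u (cov ?h (\<lambda>_. v c) (field_in c grad) ?u) (w c)
        + ?h ?u (cov ?h (\<lambda>_. w c) (field_in c grad) ?u) (v c))"
      unfolding cov_eta[symmetric] L.sym[OF u, of "v c" "_ *\<^sub>R _"] by (simp add: L.metric_simps[OF u] distrib_left)
    \<comment> \<open>Symmetry of the Hessian merges the two halves of the Lie derivative; the
      resulting factor 2 cancels the 1/2 of the soliton equation.\<close>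
    also have "?h ?u (cov ?h (\<lambda>_. w c) (field_in c grad) ?u) (v c) = ?h ?u (cov ?h (\<lambda>_. v c) (field_in c grad) ?u) (w c)"
      using L.hessian_sym[OF u] by (simp add: cov_def)
    finally show ?thesis by simp
  qed
  finally show "1/2 * lie_metric ?h (field_in c (\<lambda>p c. \<zeta>1 p c - \<eta> p c)) ?u (v c) (w c) + ricci ?h ?u (v c) (w c)
      = l * g1 p v w"
    using soliton_in(1)[OF sol X1 X2 c d, of "v c" "w c"] B.metric_in_eq[OF c v w]
    by (simp add: diff_divide_distrib)
qed

text \<open>For fixed p the factor (f p)^2 is constant on \<open>M2\<close>, hence passes through
  the Lie derivative and absorbs the coefficient of the Lie derivative of g2. All remaining base
  terms are multiples of g2 and form the soliton constant.\<close>

lemma fibre_soliton: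
  assumes sol: "ricci_soliton M g (\<lambda>m c. lift1 M1 M2 \<zeta>1 m c + lift2 M1 M2 \<zeta>2 m c) l"
    and X1: "vector_field M1 \<zeta>1" and X2: "vector_field M2 \<zeta>2" and p: "p \<in> points M1"
  shows "ricci_soliton M2 g2 (\<lambda>q c. (f p)\<^sup>2 *\<^sub>R \<zeta>2 q c)
    (l * (f p)\<^sup>2 + f_sharp DIM('f) M1 g1 f p - f p * dir_deriv M1 p (\<zeta>1 p) f)"
  unfolding ricci_soliton_def
proof (intro conjI ballI)
  show "pseudo_riemannian M2 g2" by (rule F.pseudo_riemannian)
  show "vector_field M2 (\<lambda>q c. (f p)\<^sup>2 *\<^sub>R \<zeta>2 q c)"
    using F.vector_field_lincomb[OF X2 X2, of "(f p)\<^sup>2" 0] by simp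
  fix q d v w assume q: "q \<in> points M2" and d: "d \<in> charts_at M2 q"
    and v: "v \<in> tangent_space M2 q" and w: "w \<in> tangent_space M2 q"
  note d' = F.charts_atD[OF d]
  note u = F.chart_map_range[OF d'(2)]
  interpret L: local_metric "chart_range d" "metric_in M2 g2 d" using F.local_metric_in[OF d'(1)] .
  let ?c = "some_chart M1 p" and ?h = "metric_in M2 g2 d" and ?u = "chart_map d q"
  have c: "?c \<in> charts_at M1 p" using B.some_chart[OF p] .
  have D: "frechet_derivative (field_in d (\<lambda>q c. (f p)\<^sup>2 *\<^sub>R \<zeta>2 q c)) (at ?u) =
      (\<lambda>x. (f p)\<^sup>2 *\<^sub>R frechet_derivative (field_in d \<zeta>2) (at ?u) x)"
    using has_derivative_scaleR_right[OF has_frechet_derivative[OF F.field_in_differentiable[OF X2 d'(1) u]]]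
    by (intro frechet_derivative_eqI) (simp add: field_in_def[abs_def])
  have N: "field_in d (\<lambda>q c. (f p)\<^sup>2 *\<^sub>R \<zeta>2 q c) ?u = (f p)\<^sup>2 *\<^sub>R field_in d \<zeta>2 ?u"
    by (simp add: field_in_def)
  have "lie_metric ?h (field_in d (\<lambda>q c. (f p)\<^sup>2 *\<^sub>R \<zeta>2 q c)) ?u (v d) (w d) =
      (f p)\<^sup>2 * lie_metric ?h (field_in d \<zeta>2) ?u (v d) (w d)"
    unfolding L.lie_metric_eq[OF u] D N
    by (simp add: L.metric_simps[OF u] L.christoffel_simps[OF u] distrib_left)
  moreover have "dir_deriv M1 p (\<zeta>1 p) f = frechet_derivative (fun_in ?c f) (at (chart_map ?c p)) (\<zeta>1 p ?c)"
    by (simp add: dir_deriv_def Let_def)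
  ultimately show "1/2 * lie_metric ?h (field_in d (\<lambda>q c. (f p)\<^sup>2 *\<^sub>R \<zeta>2 q c)) ?u (v d) (w d) + ricci ?h ?u (v d) (w d)
      = (l * (f p)\<^sup>2 + f_sharp DIM('f) M1 g1 f p - f p * dir_deriv M1 p (\<zeta>1 p) f) * g2 q v w"
    using soliton_in(2)[OF sol X1 X2 c d, of "v d" "w d"] F.metric_in_eq[OF d v w]
    by (simp add: f_sharp_eq[OF p] algebra_simps)
qed

end

theorem theorem1:
  fixes M1 :: "('a, 'e::euclidean_space) manifold"
    and M2 :: "('b, 'f::euclidean_space) manifold"
    and g1 :: "('a, 'e) metric" and g2 :: "('b, 'f) metric"
    and f :: "'a \<Rightarrow> real"
    and \<zeta>1 :: "('a, 'e) vfield" and \<zeta>2 :: "('b, 'f) vfield"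
    and l :: real
  assumes "pseudo_riemannian M1 g1" and "pseudo_riemannian M2 g2"
    and "smooth_fun M1 f" and "\<forall>p\<in>points M1. f p > 0"
    and "vector_field M1 \<zeta>1" and "vector_field M2 \<zeta>2"
    and "ricci_soliton (prod_manifold M1 M2) (warped_metric M1 g1 f M2 g2)
           (\<lambda>m c. lift1 M1 M2 \<zeta>1 m c + lift2 M1 M2 \<zeta>2 m c) l"
  shows "(\<forall>\<eta>1. vector_field M1 \<eta>1 \<and>
            (\<forall>X1. vector_field M1 X1 \<longrightarrow>
               (\<forall>p\<in>points M1.
                  (\<lambda>c. (real DIM('f) / f p) *\<^sub>R cov_deriv M1 g1 X1 (gradient M1 g1 f) p c)
                    = cov_deriv M1 g1 X1 \<eta>1 p)) \<longrightarrow>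
            ricci_soliton M1 g1 (\<lambda>p c. \<zeta>1 p c - \<eta>1 p c) l)
       \<and> ((\<lambda>p. l * (f p)\<^sup>2 + f_sharp DIM('f) M1 g1 f p - f p * dir_deriv M1 p (\<zeta>1 p) f)
              constant_on points M1 \<longrightarrow>
          (\<forall>p0\<in>points M1.
             ricci_soliton M2 g2 (\<lambda>q c. (f p0)\<^sup>2 *\<^sub>R \<zeta>2 q c)
               (l * (f p0)\<^sup>2 + f_sharp DIM('f) M1 g1 f p0 - f p0 * dir_deriv M1 p0 (\<zeta>1 p0) f)))"
proof -
  \<comment> \<open>The geometry of the product is read off from the soliton hypothesis.\<close>
  have "pseudo_riemannian (prod_manifold M1 M2) (warped_metric M1 g1 f M2 g2)"
    using assms(7) by (simp add: ricci_soliton_def)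
  then interpret warped_mfd M1 g1 f M2 g2
    using assms(1-4) by unfold_locales (auto simp: pseudo_riemannian_def)
  show ?thesis
    using base_soliton[OF assms(7,5,6)] fibre_soliton[OF assms(7,5,6)] by simp
qed

end
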